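(* Let $0<\beta<1$, $0<\alpha<n$ with $\alpha+\beta<n$, $1<p<n/(\alpha+\beta)$, $1/s=1/p-(\alpha+\beta)/n$, $0<\kappa<\min\{p/s,p\beta/n\}$, and let $w$ be a weight with $w^s\in A_1$. If $b\in Lip_\beta(\mathbb R^n)$, then $[b,I_\alpha]$ is bounded from $L^{p,\kappa}(w^p,w^s)$ to $L^{s,\kappa s/p}(w^s)$; that is, there is $C$ independent of $f$ with $$\|[b,I_\alpha]f\|_{L^{s,\kappa s/p}(w^s)}\le C\|b\|_{Lip_\beta}\|f\|_{L^{p,\kappa}(w^p,w^s)}.$$
   Context: All cubes have sides parallel to the axes. A weight is a locally integrable function on $\mathbb R^n$ that is positive a.e.; for a weight $u$ and a cube $Q$, $u(Q)=\int_Q u(x)\,dx$ (so e.g. $w^s(Q)=\int_Q w^s$). $w\in A_1$ means $\frac1{|Q|}\int_Q w\le C\,\mathrm{ess\,inf}_Q w$ for all cubes $Q$. The fractional integral is $I_\alpha f(x)=c_{n,\alpha}\int_{\mathbb R^n}\frac{f(y)}{|x-y|^{n-\alpha}}dy$ ($0<\alpha<n$, $c_{n,\alpha}>0$ a normalizing constant), and for locally integrable $b$, $[b,I_\alpha]f(x)=b(x)I_\alpha f(x)-I_\alpha(bf)(x)$. For $0<\beta<1$, with $b_Q=\frac1{|Q|}\int_Q b$, $\|b\|_{Lip_\beta}=\sup_Q\frac{1}{|Q|^{\beta/n}}\frac1{|Q|}\int_Q|b(x)-b_Q|\,dx$ and $Lip_\beta(\mathbb R^n)$ is the set of $b$ with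 this finite. For $1\le p<\infty$, $0<\kappa<1$ and weights $u,v$, the weighted Morrey space $L^{p,\kappa}(u,v)$ consists of $f\in L^p_{loc}(u)$ with $\|f\|_{L^{p,\kappa}(u,v)}=\sup_Q\big(\frac1{v(Q)^\kappa}\int_Q|f|^pu\big)^{1/p}<\infty$, and $L^{p,\kappa}(w)=L^{p,\kappa}(w,w)$. *)

theory Defs
  imports "HOL-Analysis.Analysis"
begin

text \<open>Cubes with sides parallel to the axes (closed; boundaries are null sets).\<close>
definition cube :: "'a::euclidean_space set \<Rightarrow> bool" where
  "cube Q \<longleftrightarrow> (\<exists>x h. h > 0 \<and> Q = cbox x (x + h *\<^sub>R One))"

text \<open>Locally integrable: integrable on every cube (equivalently on every compact set).\<close>
definition loc_int :: "('a::euclidean_space \<Rightarrow> real) \<Rightarrow> bool" where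
  "loc_int u \<longleftrightarrow> u \<in> borel_measurable lebesgue \<and>
     (\<forall>Q. cube Q \<longrightarrow> set_integrable lebesgue Q u)"

definition weight :: "('a::euclidean_space \<Rightarrow> real) \<Rightarrow> bool" where
  "weight u \<longleftrightarrow> loc_int u \<and> (AE x in lebesgue. 0 < u x)"

definition wmeas :: "('a::euclidean_space \<Rightarrow> real) \<Rightarrow> 'a set \<Rightarrow> real" where
  "wmeas u Q = (LINT x:Q|lebesgue. u x)"

definition avg :: "('a::euclidean_space \<Rightarrow> real) \<Rightarrow> 'a set \<Rightarrow> real" where
  "avg u Q = wmeas u Q / measure lebesgue Q"

definition ess_inf_on :: "'a::euclidean_space set \<Rightarrow> ('a \<Rightarrow> real) \<Rightarrow> real" where
  "ess_inf_on Q u = Sup {t. AE x in lebesgue. x \<in> Q \<longrightarrow> t \<le> u x}"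

definition A1 :: "('a::euclidean_space \<Rightarrow> real) \<Rightarrow> bool" where
  "A1 u \<longleftrightarrow> weight u \<and> (\<exists>C. \<forall>Q. cube Q \<longrightarrow> avg u Q \<le> C * ess_inf_on Q u)"

definition frac_int :: "real \<Rightarrow> real \<Rightarrow> ('a::euclidean_space \<Rightarrow> real) \<Rightarrow> 'a \<Rightarrow> real" where
  "frac_int c \<alpha> f x = c * (LINT y|lebesgue. f y / norm (x - y) powr (real DIM('a) - \<alpha>))"

definition commutator :: "('a::euclidean_space \<Rightarrow> real) \<Rightarrow> real \<Rightarrow> real \<Rightarrow> ('a \<Rightarrow> real) \<Rightarrow> 'a \<Rightarrow> real" where
  "commutator b c \<alpha> f x = b x * frac_int c \<alpha> f x - frac_int c \<alpha> (\<lambda>y. b y * f y) x"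

definition lip_osc :: "real \<Rightarrow> ('a::euclidean_space \<Rightarrow> real) \<Rightarrow> 'a set \<Rightarrow> real" where
  "lip_osc \<beta> b Q = 1 / (measure lebesgue Q powr (\<beta> / real DIM('a)))
      * (1 / measure lebesgue Q) * (LINT x:Q|lebesgue. \<bar>b x - avg b Q\<bar>)"

definition lip_space :: "real \<Rightarrow> ('a::euclidean_space \<Rightarrow> real) \<Rightarrow> bool" where
  "lip_space \<beta> b \<longleftrightarrow> loc_int b \<and> bdd_above (lip_osc \<beta> b ` Collect cube)"

definition lip_norm :: "real \<Rightarrow> ('a::euclidean_space \<Rightarrow> real) \<Rightarrow> real" where
  "lip_norm \<beta> b = (SUP Q\<in>Collect cube. lip_osc \<beta> b Q)"

definition morrey_quot :: "real \<Rightarrow> real \<Rightarrow> ('a::euclidean_space \<Rightarrow> real) \<Rightarrow> ('a \<Rightarrow> real)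
    \<Rightarrow> ('a \<Rightarrow> real) \<Rightarrow> 'a set \<Rightarrow> real" where
  "morrey_quot p \<kappa> u v f Q =
     (1 / (wmeas v Q powr \<kappa>) * (LINT x:Q|lebesgue. \<bar>f x\<bar> powr p * u x)) powr (1 / p)"

definition morrey_space :: "real \<Rightarrow> real \<Rightarrow> ('a::euclidean_space \<Rightarrow> real) \<Rightarrow> ('a \<Rightarrow> real)
    \<Rightarrow> ('a \<Rightarrow> real) \<Rightarrow> bool" where
  "morrey_space p \<kappa> u v f \<longleftrightarrow> f \<in> borel_measurable lebesgue \<and>
     (\<forall>Q. cube Q \<longrightarrow> set_integrable lebesgue Q (\<lambda>x. \<bar>f x\<bar> powr p * u x)) \<and>
     bdd_above (morrey_quot p \<kappa> u v f ` Collect cube)"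

definition morrey_norm :: "real \<Rightarrow> real \<Rightarrow> ('a::euclidean_space \<Rightarrow> real) \<Rightarrow> ('a \<Rightarrow> real)
    \<Rightarrow> ('a \<Rightarrow> real) \<Rightarrow> real" where
  "morrey_norm p \<kappa> u v f = (SUP Q\<in>Collect cube. morrey_quot p \<kappa> u v f Q)"

end

theory Submission
  imports Defs
begin

text \<open>
  By Campanato's characterisation \<open>b\<close> is almost everywhere Hoelder continuous, so the commutator is
  dominated by \<open>\<parallel>b\<parallel> I\<^bsub>\<gamma>\<^esub>\<bar>f\<bar>\<close> with \<open>\<gamma> = \<alpha> + \<beta>\<close>. Put \<open>u = w\<^bsup>s\<^esup>\<close>, \<open>d\<mu> = u dx\<close> and
  \<open>\<psi>(x,y) = \<bar>x - y\<bar>\<^bsup>n\<^esup> u(y)\<close>, with the supremum norm. By the \<open>A\<^sub>1\<close> condition, for almost every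
  \<open>y\<close> the cubes centred at \<open>x\<close> and at \<open>y\<close> with radius \<open>\<bar>x - y\<bar>\<close> have \<open>\<mu>\<close>-mass at most
  \<open>A \<psi>(x,y)\<close>. Hence \<open>\<mu>{\<psi> < t} \<le> A t\<close> in each variable, and the Morrey condition gives
  \<open>\<nu>{\<psi>(x,\<cdot>) < t} \<le> B t\<^bsup>\<kappa>\<^esup>\<close> for \<open>d\<nu> = \<bar>f\<bar>\<^bsup>p\<^esup> w\<^bsup>p\<^esup> dx\<close>. With \<open>\<bar>f\<bar> = h u\<^bsup>\<gamma>/n\<^esup>\<close> the potential becomes
  \<open>\<integral> h \<psi>\<^bsup>\<gamma>/n - 1\<^esup> d\<mu>\<close>. On a cube of mass \<open>U\<close> split it at \<open>\<psi> = U/A\<close>. The far part is bounded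
  pointwise by Hoelder's inequality and the growth bounds. For the near part, \<open>\<kappa> > 0\<close> leaves room in
  the exponents for a second Hoelder inequality followed by Tonelli's theorem, so that neither a maximal
  function nor interpolation of operators is needed.
\<close>

section \<open>Real powers and Hoelder's inequality for extended nonnegative functions\<close>

text \<open>Intended for positive exponents: \<open>0\<close> is sent to \<open>0\<close> and \<open>\<infinity>\<close> to \<open>\<infinity>\<close> whatever the exponent.\<close>
definition ennreal_powr :: "ennreal \<Rightarrow> real \<Rightarrow> ennreal" (infixr "epowr" 80) where
  "x epowr a = (if x = top then top else ennreal (enn2real x powr a))"

lemma top_epowr [simp]: "top epowr a = top"
  by (simp add: ennreal_powr_def)

lemma ennreal_epowr [simp]: "0 \<le> x \<Longrightarrow> ennreal x epowr a = ennreal (x powr a)"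
  by (simp add: ennreal_powr_def)

lemma zero_epowr [simp]: "0 epowr a = 0"
  by (simp add: ennreal_powr_def)

lemma epowr_one [simp]: "x epowr 1 = x"
  by (cases x) (simp_all add: ennreal_powr_def)

lemma epowr_mono: "x \<le> y \<Longrightarrow> 0 \<le> a \<Longrightarrow> x epowr a \<le> y epowr a"
  by (cases x; cases y) (auto simp: top_unique intro!: ennreal_leI powr_mono2)

lemma epowr_mult: "(x * y) epowr a = x epowr a * y epowr a"
proof (cases "x = top \<or> y = top")
  case True
  then show ?thesis
    by (cases x; cases y) (auto simp: ennreal_mult_top ennreal_top_mult)
next
  case False
  then show ?thesis
    by (cases x; cases y) (auto simp: ennreal_mult[symmetric] powr_mult)
qed

lemma epowr_epowr: "(x epowr a) epowr b = x epowr (a * b)"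
  by (cases x) (simp_all add: powr_powr)

lemma borel_measurable_epowr [measurable (raw)]:
  assumes [measurable]: "f \<in> borel_measurable M"
  shows "(\<lambda>x. f x epowr a) \<in> borel_measurable M"
  unfolding ennreal_powr_def by measurable

lemma add_epowr_le:
  assumes "0 \<le> a"
  shows "(x + y) epowr a \<le> ennreal (2 powr a) * (x epowr a + y epowr a)"
proof -
  have "x + y \<le> 2 * max x y"
    by (simp add: mult_2 add_mono)
  then have "(x + y) epowr a \<le> ennreal (2 powr a) * max x y epowr a"
    using assms epowr_mono[of "x + y" "2 * max x y" a] ennreal_epowr[of 2 a] by (simp add: epowr_mult)
  also have "\<dots> \<le> ennreal (2 powr a) * (x epowr a + y epowr a)"
    by (intro mult_left_mono) (auto simp: max_def intro: add_increasing add_increasing2)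
  finally show ?thesis .
qed

lemma Youngs_inequality_ennreal:
  assumes "0 < a" "0 < b" "a + b = 1"
  shows "x epowr a * y epowr b \<le> ennreal a * x + ennreal b * y"
proof (cases "x = top \<or> y = top")
  case True
  then show ?thesis using assms by (auto simp: ennreal_mult_top)
next
  case False
  then obtain r t where real: "0 \<le> r" "x = ennreal r" "0 \<le> t" "y = ennreal t"
    by (cases x; cases y) auto
  have "r powr a * t powr b \<le> a * r + b * t"
    using assms real by (cases "r = 0 \<or> t = 0") (auto intro: Youngs_inequality_0)
  then show ?thesis
    using assms real
    by (simp add: ennreal_mult[symmetric] ennreal_plus[symmetric] ennreal_leI del: ennreal_plus)
qed

lemma Youngs_inequality_ennreal_scaled:
  assumes "0 < a" "0 < b" "a + b = 1" and "0 < r" "0 < t"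
  shows "x epowr a * y epowr b
    \<le> ennreal (r powr a * t powr b) * (ennreal (a / r) * x + ennreal (b / t) * y)"
proof -
  define K where "K = r powr a * t powr b"
  have unit: "ennreal K * (ennreal ((1 / r) powr a) * ennreal ((1 / t) powr b)) = 1"
    using assms by (simp add: K_def ennreal_mult[symmetric] powr_divide)
  have "ennreal K * ((ennreal (1 / r) * x) epowr a * (ennreal (1 / t) * y) epowr b)
      = ennreal K * (ennreal ((1 / r) powr a) * ennreal ((1 / t) powr b)) * (x epowr a * y epowr b)"
    using assms by (simp add: epowr_mult mult_ac)
  then have "x epowr a * y epowr b
      = ennreal K * ((ennreal (1 / r) * x) epowr a * (ennreal (1 / t) * y) epowr b)"
    unfolding unit by simp
  also have "\<dots> \<le> ennreal K * (ennreal a * (ennreal (1 / r) * x) + ennreal b * (ennreal (1 / t) * y))"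
    using assms by (intro mult_left_mono Youngs_inequality_ennreal) auto
  also have "\<dots> = ennreal K * (ennreal (a / r) * x + ennreal (b / t) * y)"
    using assms by (simp add: mult.assoc[symmetric] ennreal_mult[symmetric])
  finally show ?thesis by (simp add: K_def)
qed

theorem nn_integral_Holder:
  fixes f g :: "'a \<Rightarrow> ennreal"
  assumes [measurable]: "f \<in> borel_measurable M" "g \<in> borel_measurable M"
    and exponents: "0 < a" "0 < b" "a + b = 1"
  shows "(\<integral>\<^sup>+x. f x epowr a * g x epowr b \<partial>M) \<le> (\<integral>\<^sup>+x. f x \<partial>M) epowr a * (\<integral>\<^sup>+x. g x \<partial>M) epowr b"
proof -
  define F G where "F = (\<integral>\<^sup>+x. f x \<partial>M)" and "G = (\<integral>\<^sup>+x. g x \<partial>M)"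
  consider (zero) "F = 0 \<or> G = 0" | (infinite) "F \<noteq> 0" "G \<noteq> 0" "F = top \<or> G = top"
    | (finite) r t where "0 < r" "F = ennreal r" "0 < t" "G = ennreal t"
    by (cases F; cases G) (auto simp: less_le)
  then have "(\<integral>\<^sup>+x. f x epowr a * g x epowr b \<partial>M) \<le> F epowr a * G epowr b"
  proof cases
    case zero
    then have "(AE x in M. f x = 0) \<or> (AE x in M. g x = 0)"
      by (simp add: F_def G_def nn_integral_0_iff_AE)
    then have "AE x in M. f x epowr a * g x epowr b = 0"
      by (elim disjE) (auto elim: eventually_mono)
    then show ?thesis by (simp add: nn_integral_0_iff_AE[THEN iffD2])
  next
    case infinite
    then have "F epowr a * G epowr b = top"
      by (cases F; cases G) (auto simp: ennreal_mult_top ennreal_top_mult)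
    then show ?thesis by simp
  next
    case finite
    have "(\<integral>\<^sup>+x. f x epowr a * g x epowr b \<partial>M)
        \<le> (\<integral>\<^sup>+x. ennreal (r powr a * t powr b) * (ennreal (a / r) * f x + ennreal (b / t) * g x) \<partial>M)"
      using finite exponents by (intro nn_integral_mono Youngs_inequality_ennreal_scaled)
    also have "\<dots> = ennreal (r powr a * t powr b) * (ennreal (a / r) * F + ennreal (b / t) * G)"
      by (simp add: F_def G_def nn_integral_add nn_integral_cmult)
    also have "ennreal (a / r) * F + ennreal (b / t) * G = 1"
      using finite exponents
      by (simp add: ennreal_mult[symmetric] ennreal_plus[symmetric] del: ennreal_plus)
    also have "ennreal (r powr a * t powr b) * 1 = F epowr a * G epowr b"
      using finite by (simp add: ennreal_mult)
    finally show ?thesis .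
  qed
  then show ?thesis by (simp add: F_def G_def)
qed

lemma nn_integral_powr_interpolation:
  fixes g :: "'a \<Rightarrow> real"
  assumes [measurable]: "g \<in> borel_measurable M" "S \<in> sets M" and "0 < l" "l < 1"
  shows "(\<integral>\<^sup>+x\<in>S. ennreal (g x powr (a * l + b * (1 - l))) \<partial>M)
    \<le> (\<integral>\<^sup>+x\<in>S. ennreal (g x powr a) \<partial>M) epowr l * (\<integral>\<^sup>+x\<in>S. ennreal (g x powr b) \<partial>M) epowr (1 - l)"
proof -
  have "ennreal (g x powr (a * l + b * (1 - l))) * indicator S x
      = (ennreal (g x powr a) * indicator S x) epowr l
        * (ennreal (g x powr b) * indicator S x) epowr (1 - l)" for x
    by (auto simp: indicator_def powr_add powr_powr ennreal_mult)
  then show ?thesis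
    by (simp only:) (intro nn_integral_Holder, use assms in auto)
qed

lemma nn_integral_Holder_density:
  fixes g h :: "'a \<Rightarrow> real"
  assumes [measurable]: "g \<in> borel_measurable M" "h \<in> borel_measurable M" "S \<in> sets M"
    and h_nonneg: "\<And>x. 0 \<le> h x" and p_gt_1: "1 < p" and c_eq: "c = a / p + b * (1 - 1 / p)"
  shows "(\<integral>\<^sup>+x\<in>S. ennreal (h x * g x powr c) \<partial>M)
    \<le> (\<integral>\<^sup>+x\<in>S. ennreal (g x powr a) \<partial>density M (\<lambda>x. ennreal (h x powr p))) epowr (1 / p)
      * (\<integral>\<^sup>+x\<in>S. ennreal (g x powr b) \<partial>M) epowr (1 - 1 / p)"
proof -
  have "ennreal (h x * g x powr c) * indicator S x
      = (ennreal (h x powr p) * (ennreal (g x powr a) * indicator S x)) epowr (1 / p)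
        * (ennreal (g x powr b) * indicator S x) epowr (1 - 1 / p)" for x
    using p_gt_1 h_nonneg[of x] unfolding c_eq
    by (auto simp: indicator_def powr_add powr_powr powr_mult ennreal_mult[symmetric] mult.assoc)
  then have "(\<integral>\<^sup>+x\<in>S. ennreal (h x * g x powr c) \<partial>M)
      \<le> (\<integral>\<^sup>+x. ennreal (h x powr p) * (ennreal (g x powr a) * indicator S x) \<partial>M) epowr (1 / p)
        * (\<integral>\<^sup>+x\<in>S. ennreal (g x powr b) \<partial>M) epowr (1 - 1 / p)"
    by (simp only:) (intro nn_integral_Holder, use p_gt_1 in auto)
  then show ?thesis by (simp add: nn_integral_density)
qed

section \<open>Negative powers of functions with polynomially growing sublevel sets\<close>

lemma nn_integral_UN_le_geometric:
  fixes f :: "'a \<Rightarrow> ennreal" and B :: "nat \<Rightarrow> 'a set"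
  assumes [measurable]: "f \<in> borel_measurable M" "\<And>j. B j \<in> sets M"
    and le_power: "\<And>j. (\<integral>\<^sup>+x\<in>B j. f x \<partial>M) \<le> ennreal (D * q ^ j)" and "0 \<le> D" "0 \<le> q" "q < 1"
  shows "(\<integral>\<^sup>+x\<in>(\<Union>j. B j). f x \<partial>M) \<le> ennreal (D / (1 - q))"
proof -
  have "emeasure (density M f) (\<Union>j. B j) \<le> (\<Sum>j. emeasure (density M f) (B j))"
    by (rule emeasure_subadditive_countably) auto
  also have "\<dots> \<le> (\<Sum>j. ennreal (D * q ^ j))"
    using le_power by (intro suminf_le) (auto simp: emeasure_density)
  also have "\<dots> = ennreal (D * (1 / (1 - q)))"
    using assms by (intro suminf_ennreal_eq sums_mult geometric_sums) auto
  finally show ?thesis by (simp add: emeasure_density)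
qed

lemma nn_integral_negative_power_shell:
  fixes g :: "'a \<Rightarrow> real"
  assumes [measurable]: "g \<in> borel_measurable M" and "0 < r" "0 \<le> b"
    and growth: "emeasure M {x \<in> space M. g x < 2 * r} \<le> ennreal (K * (2 * r) powr k)"
  shows "(\<integral>\<^sup>+x\<in>{x \<in> space M. r \<le> g x \<and> g x < 2 * r}. ennreal (g x powr - b) \<partial>M)
    \<le> ennreal (2 powr k * K * r powr (k - b))"
proof -
  have "(\<integral>\<^sup>+x\<in>{x \<in> space M. r \<le> g x \<and> g x < 2 * r}. ennreal (g x powr - b) \<partial>M)
      \<le> (\<integral>\<^sup>+x. ennreal (r powr - b) * indicator {x \<in> space M. g x < 2 * r} x \<partial>M)"
    using assms by (intro nn_integral_mono) (auto simp: indicator_def intro!: ennreal_leI powr_mono2')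
  also have "\<dots> = ennreal (r powr - b) * emeasure M {x \<in> space M. g x < 2 * r}"
    by (simp add: nn_integral_cmult)
  also have "\<dots> \<le> ennreal (r powr - b) * ennreal (K * (2 * r) powr k)"
    by (intro mult_left_mono growth) simp
  also have "\<dots> = ennreal (2 powr k * K * r powr (k - b))"
    using \<open>0 < r\<close>
    by (simp add: ennreal_mult'[symmetric] powr_mult powr_diff powr_minus divide_inverse mult_ac)
  finally show ?thesis .
qed

lemma nn_integral_negative_power_dyadic_shells:
  fixes g :: "'a \<Rightarrow> real" and r :: "nat \<Rightarrow> real"
  assumes [measurable]: "g \<in> borel_measurable M" and b_nonneg: "0 \<le> b" and K_nonneg: "0 \<le> K"
    and T_pos: "0 < T"
    and r_eq: "\<And>j. r j = T * 2 powr (\<sigma> * real j)" and decay: "\<sigma> * (k - b) < 0"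
    and growth: "\<And>t. 0 < t \<Longrightarrow> emeasure M {x \<in> space M. g x < t} \<le> ennreal (K * t powr k)"
  shows "(\<integral>\<^sup>+x\<in>(\<Union>j. {x \<in> space M. r j \<le> g x \<and> g x < 2 * r j}). ennreal (g x powr - b) \<partial>M)
    \<le> ennreal (2 powr k * K * T powr (k - b) / (1 - 2 powr (\<sigma> * (k - b))))"
proof (rule nn_integral_UN_le_geometric)
  fix j
  have r_pos: "0 < r j" using T_pos by (simp add: r_eq)
  have "(\<integral>\<^sup>+x\<in>{x \<in> space M. r j \<le> g x \<and> g x < 2 * r j}. ennreal (g x powr - b) \<partial>M)
      \<le> ennreal (2 powr k * K * r j powr (k - b))"
    using b_nonneg r_pos by (intro nn_integral_negative_power_shell growth) auto
  also have "r j powr (k - b) = T powr (k - b) * (2 powr (\<sigma> * (k - b))) ^ j"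
    using T_pos by (simp add: r_eq powr_mult powr_powr powr_power mult_ac)
  finally show "(\<integral>\<^sup>+x\<in>{x \<in> space M. r j \<le> g x \<and> g x < 2 * r j}. ennreal (g x powr - b) \<partial>M)
      \<le> ennreal (2 powr k * K * T powr (k - b) * (2 powr (\<sigma> * (k - b))) ^ j)"
    by (simp add: mult.assoc)
qed (use K_nonneg decay in \<open>auto simp: powr_less_one\<close>)

lemma dyadic_interval:
  fixes v T :: real
  assumes "0 < v" "0 < T"
  obtains k :: int where "T * 2 powr k \<le> v" "v < 2 * (T * 2 powr k)"
proof -
  have "2 powr \<lfloor>log 2 (v / T)\<rfloor> \<le> v / T" "v / T < 2 powr (\<lfloor>log 2 (v / T)\<rfloor> + 1)"
    using assms floor_log_eq_powr_iff[of "v / T" 2 "\<lfloor>log 2 (v / T)\<rfloor>"] by simp_all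
  then show thesis
    using assms by (intro that[of "\<lfloor>log 2 (v / T)\<rfloor>"]) (simp_all add: powr_add field_simps)
qed

definition dyadic_const :: "real \<Rightarrow> real \<Rightarrow> real" where
  "dyadic_const k b = 2 powr min k b / (1 - 2 powr - \<bar>k - b\<bar>)"

lemma dyadic_const_pos: "k \<noteq> b \<Longrightarrow> 0 < dyadic_const k b"
  by (simp add: dyadic_const_def powr_less_one)

lemma nn_integral_negative_power_near:
  fixes g :: "'a \<Rightarrow> real"
  assumes [measurable]: "g \<in> borel_measurable M" and g_nonneg: "\<And>x. 0 \<le> g x"
    and b_less: "0 \<le> b" "b < k" and K_nonneg: "0 \<le> K" and T_pos: "0 < T"
    and growth: "\<And>t. 0 < t \<Longrightarrow> emeasure M {x \<in> space M. g x < t} \<le> ennreal (K * t powr k)"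
  shows "(\<integral>\<^sup>+x\<in>{x \<in> space M. g x < T}. ennreal (g x powr - b) \<partial>M)
    \<le> ennreal (dyadic_const k b * K * T powr (k - b))"
proof -
  define r where "r j = T / 2 * 2 powr (- 1 * real j)" for j :: nat
  define shells where "shells = (\<Union>j. {x \<in> space M. r j \<le> g x \<and> g x < 2 * r j})"
  have covered: "x \<in> shells" if x_range: "x \<in> space M" "0 < g x" "g x < T" for x
  proof -
    obtain i :: int where i_dyadic: "T * 2 powr i \<le> g x" "g x < 2 * (T * 2 powr i)"
      using dyadic_interval x_range T_pos by blast
    then have "i < 0"
      using order_le_less_trans[OF i_dyadic(1) x_range(3)] T_pos powr_less_cancel_iff[of 2 i 0] by simp
    then have "r (nat (- i - 1)) = T * 2 powr i"
      by (simp add: r_def powr_add)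
    then show ?thesis
      using i_dyadic x_range by (auto simp: shells_def intro!: exI[of _ "nat (- i - 1)"])
  qed
  have "(\<integral>\<^sup>+x\<in>{x \<in> space M. g x < T}. ennreal (g x powr - b) \<partial>M)
      \<le> (\<integral>\<^sup>+x\<in>shells. ennreal (g x powr - b) \<partial>M)"
  proof (rule nn_integral_mono)
    fix x assume "x \<in> space M"
    then show "ennreal (g x powr - b) * indicator {x \<in> space M. g x < T} x
        \<le> ennreal (g x powr - b) * indicator shells x"
      using covered[of x] g_nonneg[of x] by (cases "g x = 0") (auto simp: indicator_def)
  qed
  also have "\<dots> \<le> ennreal (2 powr k * K * (T / 2) powr (k - b) / (1 - 2 powr (- 1 * (k - b))))"
    unfolding shells_def using b_less K_nonneg T_pos growth
    by (intro nn_integral_negative_power_dyadic_shells) (auto simp: r_def)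
  also have "2 powr k * K * (T / 2) powr (k - b) = 2 powr b * K * T powr (k - b)"
    using T_pos by (simp add: powr_divide powr_diff)
  finally show ?thesis using b_less by (simp add: dyadic_const_def)
qed

lemma nn_integral_negative_power_far:
  fixes g :: "'a \<Rightarrow> real"
  assumes [measurable]: "g \<in> borel_measurable M" and b_greater: "0 \<le> b" "k < b" and K_nonneg: "0 \<le> K"
    and T_pos: "0 < T"
    and growth: "\<And>t. 0 < t \<Longrightarrow> emeasure M {x \<in> space M. g x < t} \<le> ennreal (K * t powr k)"
  shows "(\<integral>\<^sup>+x\<in>{x \<in> space M. T \<le> g x}. ennreal (g x powr - b) \<partial>M)
    \<le> ennreal (dyadic_const k b * K * T powr (k - b))"
proof -
  define r where "r j = T * 2 powr (1 * real j)" for j :: nat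
  define shells where "shells = (\<Union>j. {x \<in> space M. r j \<le> g x \<and> g x < 2 * r j})"
  have covered: "x \<in> shells" if x_range: "x \<in> space M" "T \<le> g x" for x
  proof -
    obtain i :: int where i_dyadic: "T * 2 powr i \<le> g x" "g x < 2 * (T * 2 powr i)"
      using dyadic_interval[of "g x" T] x_range T_pos by auto
    then have "T * 2 powr 0 < T * 2 powr (i + 1)" using x_range by (simp add: powr_add)
    then have "0 \<le> i" using T_pos powr_less_cancel_iff[of 2 0 "i + 1"] by simp
    then have "r (nat i) = T * 2 powr i" by (simp add: r_def)
    then show ?thesis
      using i_dyadic x_range by (auto simp: shells_def intro!: exI[of _ "nat i"])
  qed
  have "(\<integral>\<^sup>+x\<in>{x \<in> space M. T \<le> g x}. ennreal (g x powr - b) \<partial>M)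
      \<le> (\<integral>\<^sup>+x\<in>shells. ennreal (g x powr - b) \<partial>M)"
    using covered by (intro nn_integral_mono) (auto simp: indicator_def)
  also have "\<dots> \<le> ennreal (2 powr k * K * T powr (k - b) / (1 - 2 powr (1 * (k - b))))"
    unfolding shells_def using b_greater K_nonneg T_pos growth
    by (intro nn_integral_negative_power_dyadic_shells) (auto simp: r_def)
  finally show ?thesis using b_greater by (simp add: dyadic_const_def)
qed

section \<open>Potentials of kernels with linear growth\<close>

locale growth_kernel = sigma_finite_measure M
  for M :: "'a measure" +
  fixes \<psi> :: "'a \<Rightarrow> 'a \<Rightarrow> real" and A p s \<kappa> :: real
  assumes kernel_measurable [measurable]: "case_prod \<psi> \<in> borel_measurable (M \<Otimes>\<^sub>M M)"
    and kernel_nonneg: "0 \<le> \<psi> x y"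
    and A_pos: "0 < A"
    and growth_right: "x \<in> space M \<Longrightarrow> 0 < t \<Longrightarrow> emeasure M {y \<in> space M. \<psi> x y < t} \<le> ennreal (A * t)"
    and growth_left: "AE y in M. \<forall>t>0. emeasure M {x \<in> space M. \<psi> x y < t} \<le> ennreal (A * t)"
    and exponents: "1 < p" "p < s" "0 < \<kappa>" "\<kappa> < p / s"
begin

definition \<theta> :: real where "\<theta> = 1 / s + (1 - 1 / p)"

abbreviation sublevel :: "'a \<Rightarrow> real \<Rightarrow> 'a set" where
  "sublevel x t \<equiv> {y \<in> space M. \<psi> x y < t}"

abbreviation superlevel :: "'a \<Rightarrow> real \<Rightarrow> 'a set" where
  "superlevel x t \<equiv> {y \<in> space M. t \<le> \<psi> x y}"

definition potential :: "('a \<Rightarrow> real) \<Rightarrow> 'a \<Rightarrow> ennreal" where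
  "potential h x = (\<integral>\<^sup>+y. ennreal (h y * \<psi> x y powr - \<theta>) \<partial>M)"

definition near_potential :: "('a \<Rightarrow> real) \<Rightarrow> real \<Rightarrow> 'a \<Rightarrow> ennreal" where
  "near_potential h T x = (\<integral>\<^sup>+y\<in>sublevel x T. ennreal (h y * \<psi> x y powr - \<theta>) \<partial>M)"

definition far_potential :: "('a \<Rightarrow> real) \<Rightarrow> real \<Rightarrow> 'a \<Rightarrow> ennreal" where
  "far_potential h T x = (\<integral>\<^sup>+y\<in>superlevel x T. ennreal (h y * \<psi> x y powr - \<theta>) \<partial>M)"

definition power_measure :: "('a \<Rightarrow> real) \<Rightarrow> 'a measure" where
  "power_measure h = density M (\<lambda>y. ennreal (h y powr p))"

definition morrey_growth :: "('a \<Rightarrow> real) \<Rightarrow> real \<Rightarrow> bool" where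
  "morrey_growth h B \<longleftrightarrow> h \<in> borel_measurable M \<and> (\<forall>y. 0 \<le> h y) \<and> 0 \<le> B \<and>
    (\<forall>x\<in>space M. \<forall>t>0. emeasure (power_measure h) (sublevel x t) \<le> ennreal (B * t powr \<kappa>))"

definition near_moment :: "('a \<Rightarrow> real) \<Rightarrow> real \<Rightarrow> real \<Rightarrow> 'a \<Rightarrow> ennreal" where
  "near_moment h a T x = (\<integral>\<^sup>+y\<in>sublevel x T. ennreal (\<psi> x y powr - a) \<partial>power_measure h)"

lemma sets_power_measure [measurable_cong, simp]: "sets (power_measure h) = sets M"
  by (simp add: power_measure_def)

lemma space_power_measure [simp]: "space (power_measure h) = space M"
  by (simp add: power_measure_def)

lemma nn_integral_near_measurable:
  assumes [measurable]: "case_prod f \<in> borel_measurable (M \<Otimes>\<^sub>M M)"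
  shows "(\<lambda>x. \<integral>\<^sup>+y\<in>sublevel x T. f x y \<partial>M) \<in> borel_measurable M"
proof -
  have "(\<lambda>x. \<integral>\<^sup>+y. (if \<psi> x y < T then f x y else 0) \<partial>M) \<in> borel_measurable M"
    by measurable
  then show ?thesis
    by (rule measurable_cong[THEN iffD1, rotated]) (auto intro!: nn_integral_cong simp: indicator_def)
qed

lemma near_potential_measurable [measurable]:
  assumes [measurable]: "h \<in> borel_measurable M"
  shows "near_potential h T \<in> borel_measurable M"
  unfolding near_potential_def[abs_def] by (intro nn_integral_near_measurable) measurable

lemma near_moment_eq:
  assumes [measurable]: "h \<in> borel_measurable M" "x \<in> space M"
  shows "near_moment h a T x
    = (\<integral>\<^sup>+y\<in>sublevel x T. ennreal (h y powr p) * ennreal (\<psi> x y powr - a) \<partial>M)"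
  unfolding near_moment_def power_measure_def
  by (subst nn_integral_density) (auto simp: mult.assoc)

lemma near_moment_measurable [measurable]:
  assumes [measurable]: "h \<in> borel_measurable M"
  shows "near_moment h a T \<in> borel_measurable M"
  by (subst measurable_cong[OF near_moment_eq]; (intro nn_integral_near_measurable)?) measurable

lemma potential_epowr_le:
  assumes [measurable]: "x \<in> space M" "h \<in> borel_measurable M"
  shows "potential h x epowr s
    \<le> ennreal (2 powr s) * (near_potential h T x epowr s + far_potential h T x epowr s)"
proof -
  have "potential h x = near_potential h T x + far_potential h T x"
    unfolding potential_def near_potential_def far_potential_def
    by (subst nn_integral_add[symmetric]; measurable?)
      (auto intro!: nn_integral_cong simp: indicator_def)
  then show ?thesis using exponents by (simp add: add_epowr_le)
qed

lemma
  assumes "morrey_growth h B" "x \<in> space M" "0 < T" "0 \<le> b"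
  shows near_moment_le: "b < \<kappa> \<Longrightarrow>
      near_moment h b T x \<le> ennreal (dyadic_const \<kappa> b * B * T powr (\<kappa> - b))"
    and far_moment_le: "\<kappa> < b \<Longrightarrow>
      (\<integral>\<^sup>+y\<in>superlevel x T. ennreal (\<psi> x y powr - b) \<partial>power_measure h)
        \<le> ennreal (dyadic_const \<kappa> b * B * T powr (\<kappa> - b))"
  using nn_integral_negative_power_near[of "\<psi> x" "power_measure h" b \<kappa> B T]
    nn_integral_negative_power_far[of "\<psi> x" "power_measure h" b \<kappa> B T] assms
  by (auto simp: near_moment_def morrey_growth_def kernel_nonneg)

lemma
  assumes "x \<in> space M" "0 < T" "0 \<le> b"
  shows nn_integral_kernel_near: "b < 1 \<Longrightarrow>
      (\<integral>\<^sup>+y\<in>sublevel x T. ennreal (\<psi> x y powr - b) \<partial>M)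
        \<le> ennreal (dyadic_const 1 b * A * T powr (1 - b))"
    and nn_integral_kernel_far: "1 < b \<Longrightarrow>
      (\<integral>\<^sup>+y\<in>superlevel x T. ennreal (\<psi> x y powr - b) \<partial>M)
        \<le> ennreal (dyadic_const 1 b * A * T powr (1 - b))"
  using nn_integral_negative_power_near[of "\<psi> x" M b 1 A T]
    nn_integral_negative_power_far[of "\<psi> x" M b 1 A T] assms A_pos growth_right[of x]
  by (auto simp: kernel_nonneg)

lemma potential_Holder:
  assumes "x \<in> space M" "h \<in> borel_measurable M" "\<And>y. 0 \<le> h y" "S \<in> sets M"
    and "\<theta> = d / p + a * (1 - 1 / p)"
  shows "(\<integral>\<^sup>+y\<in>S. ennreal (h y * \<psi> x y powr - \<theta>) \<partial>M)
    \<le> (\<integral>\<^sup>+y\<in>S. ennreal (\<psi> x y powr - d) \<partial>power_measure h) epowr (1 / p)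
      * (\<integral>\<^sup>+y\<in>S. ennreal (\<psi> x y powr - a) \<partial>M) epowr (1 - 1 / p)"
  unfolding power_measure_def using assms exponents
  by (intro nn_integral_Holder_density) auto

lemma far_potential_bound:
  "\<exists>C>0. \<forall>h B T. \<forall>x\<in>space M. morrey_growth h B \<longrightarrow> 0 < T \<longrightarrow>
    far_potential h T x \<le> ennreal (C * B powr (1 / p) * T powr (\<kappa> / p - 1 / s))"
proof -
  define q where "q = 1 - 1 / p"
  define gap where "gap = (1 / s - \<kappa> / p) / 2"
  define d where "d = \<kappa> + gap * p"
  define a where "a = 1 + gap / q"
  define C where "C = dyadic_const \<kappa> d powr (1 / p) * (dyadic_const 1 a * A) powr q"
  have q_pos: "0 < q" and "0 < gap"
    using exponents by (simp_all add: q_def gap_def field_simps)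
  then have d_gt_\<kappa>: "\<kappa> < d" and a_gt_1: "1 < a" using exponents by (simp_all add: d_def a_def)
  then have dyadic_pos: "0 < dyadic_const \<kappa> d" "0 < dyadic_const 1 a"
    by (simp_all add: dyadic_const_pos)
  have \<theta>_split: "\<theta> = d / p + a * (1 - 1 / p)"
    using exponents q_pos unfolding \<theta>_def q_def[symmetric] d_def a_def gap_def
    by (simp add: add_divide_distrib distrib_right)
  have "far_potential h T x \<le> ennreal (C * B powr (1 / p) * T powr (\<kappa> / p - 1 / s))"
    if x_space: "x \<in> space M" and h_growth: "morrey_growth h B" and T_pos: "0 < T" for h B T x
  proof -
    have "far_potential h T x \<le> ennreal (dyadic_const \<kappa> d * B * T powr (\<kappa> - d)) epowr (1 / p)
        * ennreal (dyadic_const 1 a * A * T powr (1 - a)) epowr q"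
      unfolding far_potential_def q_def using x_space h_growth T_pos d_gt_\<kappa> a_gt_1 exponents q_pos
      by (intro order_trans[OF potential_Holder[OF _ _ _ _ \<theta>_split]] mult_mono epowr_mono
          far_moment_le nn_integral_kernel_far)
        (auto simp: morrey_growth_def q_def)
    also have "\<dots> = ennreal (C * B powr (1 / p) * T powr ((\<kappa> - d) / p + (1 - a) * q))"
      using dyadic_pos A_pos T_pos h_growth
      by (simp add: C_def powr_mult powr_powr powr_add ennreal_mult[symmetric] mult_ac
          morrey_growth_def)
    also have "(\<kappa> - d) / p + (1 - a) * q = \<kappa> / p - 1 / s"
      using exponents q_pos by (simp add: d_def a_def gap_def field_simps)
    finally show ?thesis .
  qed
  moreover have "0 < C" using dyadic_pos A_pos by (simp add: C_def)
  ultimately show ?thesis by blast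
qed

lemma far_potential_epowr_bound:
  "\<exists>C>0. \<forall>h B T. \<forall>x\<in>space M. morrey_growth h B \<longrightarrow> 0 < T \<longrightarrow>
    far_potential h T x epowr s \<le> ennreal (C * B powr (s / p) * T powr (\<kappa> * s / p - 1))"
proof -
  obtain C where C_pos: "0 < C" and far_le: "\<And>h B T x. x \<in> space M \<Longrightarrow> morrey_growth h B \<Longrightarrow> 0 < T \<Longrightarrow>
      far_potential h T x \<le> ennreal (C * B powr (1 / p) * T powr (\<kappa> / p - 1 / s))"
    using far_potential_bound by blast
  have "far_potential h T x epowr s \<le> ennreal (C powr s * B powr (s / p) * T powr (\<kappa> * s / p - 1))"
    if "x \<in> space M" "morrey_growth h B" "0 < T" for h B T x
  proof -
    have "far_potential h T x epowr s \<le> ennreal (C * B powr (1 / p) * T powr (\<kappa> / p - 1 / s)) epowr s"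
      using far_le[OF that] exponents by (intro epowr_mono) auto
    then show ?thesis
      using that C_pos exponents by (simp add: powr_mult powr_powr left_diff_distrib)
  qed
  moreover have "0 < C powr s" using C_pos by simp
  ultimately show ?thesis by blast
qed

text \<open>Interpolating the first factor of \<open>potential_Holder\<close> between \<open>\<psi>\<^sup>-\<^sup>a\<close> and \<open>\<psi>\<^sup>-\<^sup>e\<close> leaves
  an integral that Tonelli's theorem can handle.\<close>
lemma near_potential_epowr_le:
  assumes h_growth: "morrey_growth h B" and x_space: "x \<in> space M" and T_pos: "0 < T"
    and a_range: "0 \<le> a" "a < 1" and e_range: "0 \<le> e" "e < \<kappa>"
    and \<theta>_split: "\<theta> = (a * (p / s) + e * (1 - p / s)) / p + a * (1 - 1 / p)"
  shows "near_potential h T x epowr s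
    \<le> ennreal ((dyadic_const \<kappa> e * B * T powr (\<kappa> - e)) powr (s / p - 1)
        * (dyadic_const 1 a * A * T powr (1 - a)) powr (s - s / p))
      * near_moment h a T x"
proof -
  define l where "l = p / s"
  define I where "I b = near_moment h b T x" for b
  define J where "J = (\<integral>\<^sup>+y\<in>sublevel x T. ennreal (\<psi> x y powr - a) \<partial>M)"
  have l_range: "0 < l" "l < 1" using exponents by (simp_all add: l_def)
  have consts_pos: "0 < dyadic_const \<kappa> e" "0 < dyadic_const 1 a" "0 \<le> B"
    using a_range e_range h_growth by (simp_all add: dyadic_const_pos morrey_growth_def)
  have "I (a * l + e * (1 - l)) \<le> I a epowr l * I e epowr (1 - l)"
    using nn_integral_powr_interpolation[of "\<psi> x" "power_measure h" "sublevel x T" l "- a" "- e"]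
      l_range x_space by (simp add: I_def near_moment_def algebra_simps)
  then have "near_potential h T x
      \<le> (I a epowr l * I e epowr (1 - l)) epowr (1 / p) * J epowr (1 - 1 / p)"
    unfolding near_potential_def I_def near_moment_def J_def l_def using x_space h_growth exponents
    by (intro order_trans[OF potential_Holder[OF _ _ _ _ \<theta>_split]] mult_right_mono epowr_mono)
      (auto simp: morrey_growth_def)
  then have "near_potential h T x epowr s
      \<le> ((I a epowr l * I e epowr (1 - l)) epowr (1 / p) * J epowr (1 - 1 / p)) epowr s"
    using exponents by (intro epowr_mono) auto
  also have "\<dots> = I a * (I e epowr (s / p - 1) * J epowr (s - s / p))"
    using exponents
    by (simp add: epowr_mult epowr_epowr l_def mult.assoc left_diff_distrib diff_divide_distrib)
  also have "\<dots> \<le> I a * (ennreal (dyadic_const \<kappa> e * B * T powr (\<kappa> - e)) epowr (s / p - 1)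
      * ennreal (dyadic_const 1 a * A * T powr (1 - a)) epowr (s - s / p))"
    unfolding I_def J_def using h_growth x_space T_pos a_range e_range exponents
    by (intro mult_left_mono mult_mono epowr_mono near_moment_le nn_integral_kernel_near)
      (auto simp: field_simps)
  finally show ?thesis
    using consts_pos A_pos by (simp add: I_def ennreal_mult[symmetric] mult.commute)
qed

lemma nn_integral_near_moment_le:
  assumes h_measurable [measurable]: "h \<in> borel_measurable M"
    and [measurable]: "E \<in> sets M" "E' \<in> sets M"
    and T_pos: "0 < T" and a_range: "0 \<le> a" "a < 1"
    and near_imp_mem: "AE y in M. \<forall>x\<in>E. \<psi> x y < T \<longrightarrow> y \<in> E'"
  shows "(\<integral>\<^sup>+x\<in>E. near_moment h a T x \<partial>M)
    \<le> ennreal (dyadic_const 1 a * A * T powr (1 - a)) * emeasure (power_measure h) E'"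
proof -
  interpret pair_sigma_finite M M ..
  define D where "D = dyadic_const 1 a * A * T powr (1 - a)"
  define k where "k x y = ennreal (\<psi> x y powr - a) *
    indicator {z. \<psi> (fst z) (snd z) < T \<and> fst z \<in> E} (x, y)" for x y
  have [measurable]: "case_prod k \<in> borel_measurable (M \<Otimes>\<^sub>M M)"
    unfolding k_def by measurable
  have "(\<integral>\<^sup>+x\<in>E. near_moment h a T x \<partial>M) = (\<integral>\<^sup>+x. (\<integral>\<^sup>+y. ennreal (h y powr p) * k x y \<partial>M) \<partial>M)"
    unfolding k_def by (intro nn_integral_cong)
      (auto simp: near_moment_eq[OF h_measurable] indicator_def intro!: nn_integral_cong)
  also have "\<dots> = (\<integral>\<^sup>+y. (\<integral>\<^sup>+x. ennreal (h y powr p) * k x y \<partial>M) \<partial>M)"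
    by (rule Fubini'[symmetric]) measurable
  also have "\<dots> \<le> (\<integral>\<^sup>+y. ennreal (h y powr p) * (ennreal D * indicator E' y) \<partial>M)"
  proof (rule nn_integral_mono_AE, use growth_left near_imp_mem AE_space in eventually_elim)
    case (elim y)
    have "(\<integral>\<^sup>+x. k x y \<partial>M)
        \<le> (\<integral>\<^sup>+x. ennreal (\<psi> x y powr - a) * indicator {x \<in> space M. \<psi> x y < T} x * indicator E' y \<partial>M)"
      using elim by (intro nn_integral_mono) (auto simp: k_def indicator_def)
    also have "\<dots> = (\<integral>\<^sup>+x\<in>{x \<in> space M. \<psi> x y < T}. ennreal (\<psi> x y powr - a) \<partial>M) * indicator E' y"
      using elim by (intro nn_integral_multc) measurable
    also have "\<dots> \<le> ennreal D * indicator E' y"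
      unfolding D_def using elim T_pos a_range A_pos
      by (intro mult_right_mono nn_integral_negative_power_near) (auto simp: kernel_nonneg)
    finally show ?case
      using elim by (simp add: nn_integral_cmult mult_left_mono)
  qed
  also have "\<dots> = ennreal D * emeasure (power_measure h) E'"
    by (simp add: power_measure_def emeasure_density nn_integral_cmult[symmetric] mult_ac)
  finally show ?thesis by (simp add: D_def)
qed

lemma near_exponents:
  obtains a e where "0 < a" "a < 1" "0 < e" "e < \<kappa>"
    "(1 - a) * (s - s / p + 1) = e * (s / p - 1)"
    "\<theta> = (a * (p / s) + e * (1 - p / s)) / p + a * (1 - 1 / p)"
proof -
  define m where "m = s / p - 1"
  define r where "r = s - s / p + 1"
  define e where "e = min \<kappa> (r / m) / 2"
  define a where "a = 1 - e * m / r"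
  have m_pos: "0 < m" and r_gt_1: "1 < r" "r = \<theta> * s"
    using exponents by (auto simp: m_def r_def \<theta>_def field_simps)
  have e_range: "0 < e" "e < \<kappa>"
    using exponents m_pos r_gt_1(1) by (simp_all add: e_def min_def)
  have "e \<le> r / m / 2" unfolding e_def by (intro divide_right_mono) auto
  then have "e * m \<le> r / 2" using m_pos by (simp add: field_simps)
  then have "e * m < r" using r_gt_1(1) by simp
  then have a_range: "0 < a" "a < 1" "(1 - a) * r = e * m" "a * r = r - e * m"
    using e_range m_pos r_gt_1(1) by (simp_all add: a_def left_diff_distrib)
  have "((a * (p / s) + e * (1 - p / s)) / p + a * (1 - 1 / p)) * s = a * r + e * m"
    using exponents by (simp add: m_def r_def field_simps)
  also have "\<dots> = \<theta> * s" using a_range(4) r_gt_1(2) by simp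
  finally have "\<theta> = (a * (p / s) + e * (1 - p / s)) / p + a * (1 - 1 / p)"
    using exponents by simp
  then show thesis using a_range(1-3) e_range unfolding m_def r_def by (intro that[of a e])
qed

lemma near_potential_bound:
  "\<exists>C>0. \<forall>h B T. \<forall>E\<in>sets M. \<forall>E'\<in>sets M. morrey_growth h B \<longrightarrow> 0 < T \<longrightarrow>
    (AE y in M. \<forall>x\<in>E. \<psi> x y < T \<longrightarrow> y \<in> E') \<longrightarrow>
    (\<integral>\<^sup>+x\<in>E. near_potential h T x epowr s \<partial>M)
      \<le> ennreal (C * B powr (s / p - 1) * T powr (\<kappa> * (s / p - 1))) * emeasure (power_measure h) E'"
proof -
  obtain a e where a_range: "0 < a" "a < 1" and e_range: "0 < e" "e < \<kappa>"
    and balance: "(1 - a) * (s - s / p + 1) = e * (s / p - 1)"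
    and \<theta>_split: "\<theta> = (a * (p / s) + e * (1 - p / s)) / p + a * (1 - 1 / p)"
    by (rule near_exponents)
  define m where "m = s / p - 1"
  define r where "r = s - s / p"
  define C where "C = dyadic_const \<kappa> e powr m * (dyadic_const 1 a * A) powr (r + 1)"
  have dyadic_pos: "0 < dyadic_const \<kappa> e" "0 < dyadic_const 1 a"
    using a_range e_range by (simp_all add: dyadic_const_pos)
  have "(\<integral>\<^sup>+x\<in>E. near_potential h T x epowr s \<partial>M)
      \<le> ennreal (C * B powr m * T powr (\<kappa> * m)) * emeasure (power_measure h) E'"
    if [measurable]: "E \<in> sets M" "E' \<in> sets M" and h_growth: "morrey_growth h B" and T_pos: "0 < T"
      and near_imp_mem: "AE y in M. \<forall>x\<in>E. \<psi> x y < T \<longrightarrow> y \<in> E'" for h B T E E'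
  proof -
    define D where "D = dyadic_const 1 a * A * T powr (1 - a)"
    define K where "K = (dyadic_const \<kappa> e * B * T powr (\<kappa> - e)) powr m * D powr r"
    have D_pos: "0 < D" using dyadic_pos T_pos A_pos by (simp add: D_def)
    have [measurable]: "h \<in> borel_measurable M" and B_nonneg: "0 \<le> B"
      using h_growth by (simp_all add: morrey_growth_def)
    have "(\<integral>\<^sup>+x\<in>E. near_potential h T x epowr s \<partial>M) \<le> (\<integral>\<^sup>+x\<in>E. ennreal K * near_moment h a T x \<partial>M)"
      unfolding K_def D_def m_def r_def using h_growth T_pos a_range e_range \<theta>_split
      by (intro nn_integral_mono mult_right_mono near_potential_epowr_le) auto
    also have "\<dots> = ennreal K * (\<integral>\<^sup>+x\<in>E. near_moment h a T x \<partial>M)"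
      by (simp add: mult.assoc nn_integral_cmult)
    also have "\<dots> \<le> ennreal K * (ennreal D * emeasure (power_measure h) E')"
      unfolding D_def using T_pos a_range near_imp_mem
      by (intro mult_left_mono nn_integral_near_moment_le) auto
    also have "\<dots> = ennreal (K * D) * emeasure (power_measure h) E'"
      using D_pos by (simp add: K_def ennreal_mult mult.assoc)
    also have "K * D = (dyadic_const \<kappa> e * B * T powr (\<kappa> - e)) powr m * D powr (r + 1)"
      using D_pos by (simp add: K_def powr_add)
    also have "\<dots> = C * B powr m * (T powr ((\<kappa> - e) * m) * T powr ((1 - a) * (r + 1)))"
      using B_nonneg dyadic_pos A_pos by (simp add: C_def D_def powr_mult powr_powr)
    also have "T powr ((\<kappa> - e) * m) * T powr ((1 - a) * (r + 1)) = T powr (\<kappa> * m)"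
      using balance unfolding powr_add[symmetric] m_def r_def by (simp add: left_diff_distrib)
    finally show ?thesis .
  qed
  moreover have "0 < C" using dyadic_pos A_pos by (simp add: C_def)
  ultimately show ?thesis unfolding m_def by blast
qed

theorem potential_bound:
  "\<exists>C>0. \<forall>h B T. \<forall>E\<in>sets M. \<forall>E'\<in>sets M. morrey_growth h B \<longrightarrow> 0 < T \<longrightarrow>
    (AE y in M. \<forall>x\<in>E. \<psi> x y < T \<longrightarrow> y \<in> E') \<longrightarrow>
    (\<integral>\<^sup>+x\<in>E. potential h x epowr s \<partial>M)
      \<le> ennreal (C * B powr (s / p) * T powr (\<kappa> * s / p - 1)) * emeasure M E
        + ennreal (C * B powr (s / p - 1) * T powr (\<kappa> * (s / p - 1))) * emeasure (power_measure h) E'"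
proof -
  obtain C where C_pos: "0 < C" and near_le: "\<And>h B T E E'. E \<in> sets M \<Longrightarrow> E' \<in> sets M \<Longrightarrow>
      morrey_growth h B \<Longrightarrow> 0 < T \<Longrightarrow> AE y in M. \<forall>x\<in>E. \<psi> x y < T \<longrightarrow> y \<in> E' \<Longrightarrow>
      (\<integral>\<^sup>+x\<in>E. near_potential h T x epowr s \<partial>M)
        \<le> ennreal (C * B powr (s / p - 1) * T powr (\<kappa> * (s / p - 1))) * emeasure (power_measure h) E'"
    using near_potential_bound by blast
  obtain D where D_pos: "0 < D" and far_le: "\<And>h B T x. x \<in> space M \<Longrightarrow> morrey_growth h B \<Longrightarrow> 0 < T \<Longrightarrow>
      far_potential h T x epowr s \<le> ennreal (D * B powr (s / p) * T powr (\<kappa> * s / p - 1))"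
    using far_potential_epowr_bound by blast
  define K where "K = 2 powr s * (C + D)"
  have "(\<integral>\<^sup>+x\<in>E. potential h x epowr s \<partial>M)
      \<le> ennreal (K * X) * emeasure M E + ennreal (K * Y) * emeasure (power_measure h) E'"
    if E_sets [measurable]: "E \<in> sets M" "E' \<in> sets M" and h_growth: "morrey_growth h B"
      and T_pos: "0 < T"
      and near_imp_mem: "AE y in M. \<forall>x\<in>E. \<psi> x y < T \<longrightarrow> y \<in> E'"
      and X_def: "X = B powr (s / p) * T powr (\<kappa> * s / p - 1)"
      and Y_def: "Y = B powr (s / p - 1) * T powr (\<kappa> * (s / p - 1))" for h B T E E' X Y
  proof -
    have [measurable]: "h \<in> borel_measurable M" using h_growth by (simp add: morrey_growth_def)
    have pointwise: "potential h x epowr s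
        \<le> ennreal (2 powr s) * (near_potential h T x epowr s + ennreal (D * X))" if "x \<in> space M" for x
      using order_trans[OF potential_epowr_le
          mult_left_mono[OF add_left_mono[OF far_le[OF that h_growth T_pos]]]] that
      by (simp add: X_def mult.assoc)
    have "(\<integral>\<^sup>+x\<in>E. potential h x epowr s \<partial>M) \<le> (\<integral>\<^sup>+x. ennreal (2 powr s)
        * (near_potential h T x epowr s * indicator E x + ennreal (D * X) * indicator E x) \<partial>M)"
      using pointwise by (intro nn_integral_mono) (auto simp: indicator_def)
    also have "\<dots> = ennreal (2 powr s)
        * ((\<integral>\<^sup>+x\<in>E. near_potential h T x epowr s \<partial>M) + ennreal (D * X) * emeasure M E)"
      by (simp add: nn_integral_cmult nn_integral_add)
    also have "\<dots> \<le> ennreal (2 powr s)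
        * (ennreal (C * Y) * emeasure (power_measure h) E' + ennreal (D * X) * emeasure M E)"
      using near_le[OF E_sets h_growth T_pos near_imp_mem]
      by (intro mult_left_mono add_right_mono) (simp_all add: Y_def mult.assoc)
    also have "\<dots> = ennreal (2 powr s * D * X) * emeasure M E
        + ennreal (2 powr s * C * Y) * emeasure (power_measure h) E'"
      using C_pos D_pos by (simp add: X_def Y_def ennreal_mult distrib_left mult.assoc add.commute)
    also have "\<dots> \<le> ennreal (K * X) * emeasure M E + ennreal (K * Y) * emeasure (power_measure h) E'"
      using C_pos D_pos
      by (intro add_mono mult_right_mono ennreal_leI)
        (auto simp: X_def Y_def K_def intro!: mult_right_mono)
    finally show ?thesis .
  qed
  moreover have "0 < K" using C_pos D_pos by (simp add: K_def add_pos_pos)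
  ultimately show ?thesis by (intro exI[of _ K]) (simp add: mult.assoc)
qed

end

section \<open>Centred cubes\<close>

definition ccube :: "'a::euclidean_space \<Rightarrow> real \<Rightarrow> 'a set" where
  "ccube x r = cbox (x - r *\<^sub>R One) (x + r *\<^sub>R One)"

lemma mem_ccube: "y \<in> ccube x r \<longleftrightarrow> infnorm (x - y) \<le> r"
  by (auto simp: ccube_def mem_box infnorm_Max inner_diff_left inner_add_left abs_le_iff algebra_simps)

lemma ccube_mono: "infnorm (x - z) + r \<le> R \<Longrightarrow> ccube x r \<subseteq> ccube z R"
proof
  fix y assume "infnorm (x - z) + r \<le> R" "y \<in> ccube x r"
  then show "y \<in> ccube z R"
    using infnorm_triangle[of "z - x" "x - y"] infnorm_sub[of z x] by (simp add: mem_ccube)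
qed

lemma ccube_mono_radius: "r \<le> R \<Longrightarrow> ccube x r \<subseteq> ccube x R"
  by (simp add: ccube_mono infnorm_0)

lemma ccube_borel [measurable, simp]: "ccube x r \<in> sets borel"
  by (simp add: ccube_def)

lemma cube_ccube:
  assumes "0 < r"
  shows "cube (ccube x r)"
proof -
  have "ccube x r = cbox (x - r *\<^sub>R One) ((x - r *\<^sub>R One) + (2 * r) *\<^sub>R One)"
    unfolding ccube_def mult_2 scaleR_add_left by (simp only: add.assoc[symmetric] diff_add_cancel)
  then show ?thesis using assms unfolding cube_def by (metis mult_pos_pos zero_less_numeral)
qed

lemma cube_obtain_ccube:
  assumes "cube Q"
  obtains x r where "0 < r" "Q = ccube x r"
proof -
  obtain z h where corner: "h > 0" "Q = cbox z (z + h *\<^sub>R One)"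
    using assms by (auto simp: cube_def)
  have "Q = ccube (z + (h / 2) *\<^sub>R One) (h / 2)"
    using corner by (simp add: ccube_def add.assoc flip: scaleR_add_left)
  then show ?thesis using that[of "h / 2"] corner by simp
qed

lemma cubes_nonempty: "Collect (cube :: 'a::euclidean_space set \<Rightarrow> bool) \<noteq> {}"
  using cube_ccube[of 1 "0::'a"] by auto

lemma emeasure_ccube:
  fixes x :: "'a::euclidean_space"
  assumes "0 \<le> r"
  shows "emeasure lborel (ccube x r) = ennreal ((2 * r) ^ DIM('a))"
  using assms unfolding ccube_def
  by (simp add: emeasure_lborel_cbox_eq inner_diff_left inner_add_left)

lemma measure_ccube:
  fixes x :: "'a::euclidean_space"
  assumes "0 \<le> r"
  shows "measure lborel (ccube x r) = (2 * r) ^ DIM('a)"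
  using emeasure_ccube[OF assms, of x] assms by (simp add: measure_def)

lemma borel_measurable_infnorm [measurable]:
  "(infnorm :: 'a::euclidean_space \<Rightarrow> real) \<in> borel_measurable borel"
  by (intro borel_measurable_continuous_onI continuous_intros continuous_on_id)

lemma cofinal_sequence:
  fixes R :: "real set"
  assumes "R \<noteq> {}"
  obtains f :: "nat \<Rightarrow> real" where "incseq f" "range f \<subseteq> R" "\<forall>r\<in>R. \<exists>m. r \<le> f m"
proof (cases "\<exists>m\<in>R. \<forall>r\<in>R. r \<le> m")
  case True
  then obtain m where "m \<in> R" "\<forall>r\<in>R. r \<le> m" by blast
  then show ?thesis by (intro that[of "\<lambda>_. m"]) auto
next
  case False
  obtain g :: "nat \<Rightarrow> ereal" where g_cofinal: "incseq g" "range g \<subseteq> ereal ` R"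
    "Sup (ereal ` R) = (SUP i. g i)"
    using Sup_countable_SUP[of "ereal ` R"] assms by auto
  define f where "f i = real_of_ereal (g i)" for i
  have g_eq: "g i = ereal (f i)" and f_in: "f i \<in> R" for i
  proof -
    have "g i \<in> ereal ` R" using g_cofinal(2) by auto
    then show "g i = ereal (f i)" "f i \<in> R" by (auto simp: f_def)
  qed
  have "\<exists>m. r \<le> f m" if r_in: "r \<in> R" for r
  proof -
    obtain r' where "r' \<in> R" "r < r'" using False r_in by (meson not_le)
    then have "ereal r < (SUP i. g i)"
      unfolding g_cofinal(3)[symmetric] by (auto simp: less_Sup_iff)
    then show ?thesis by (auto simp: less_SUP_iff g_eq intro: less_imp_le)
  qed
  then show ?thesis using g_cofinal(1) f_in by (intro that[of f]) (auto simp: incseq_def g_eq)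
qed

lemma emeasure_le_if_AE_in_small_member:
  fixes B :: "real \<Rightarrow> 'a set"
  assumes B_chain: "\<And>r. B r \<in> sets M" "\<And>r r'. r \<le> r' \<Longrightarrow> B r \<subseteq> B r'"
    and AE_small: "AE y in M. y \<in> S \<longrightarrow> (\<exists>r. y \<in> B r \<and> emeasure M (B r) \<le> c)"
  shows "emeasure M S \<le> c"
proof (cases "S \<in> sets M")
  case False
  then show ?thesis by (simp add: emeasure_notin_sets)
next
  case S_sets: True
  define R where "R = {r. emeasure M (B r) \<le> c}"
  show ?thesis
  proof (cases "R = {}")
    case True
    then have "AE y in M. y \<notin> S" using AE_small by (auto simp: R_def elim: eventually_mono)
    then have "emeasure M S = 0"
      using S_sets sets.sets_into_space[OF S_sets] by (subst (asm) AE_iff_measurable[of S]) auto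
    then show ?thesis by simp
  next
    case False
    obtain f :: "nat \<Rightarrow> real" where f_cofinal: "incseq f" "range f \<subseteq> R" "\<forall>r\<in>R. \<exists>j. r \<le> f j"
      by (rule cofinal_sequence[OF False])
    have "emeasure M S \<le> emeasure M (\<Union>j. B (f j))"
    proof (rule emeasure_mono_AE)
      show "AE y in M. y \<in> S \<longrightarrow> y \<in> (\<Union>j. B (f j))"
        using AE_small
      proof eventually_elim
        case (elim y)
        show ?case
        proof
          assume "y \<in> S"
          then obtain r where "y \<in> B r" "r \<in> R" using elim by (auto simp: R_def)
          then obtain j where "r \<le> f j" using f_cofinal(3) by blast
          then show "y \<in> (\<Union>j. B (f j))" using B_chain(2) \<open>y \<in> B r\<close> by auto
        qed
      qed
    qed (use B_chain in auto)
    also have "\<dots> = (SUP j. emeasure M (B (f j)))"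
      using f_cofinal(1) B_chain by (intro SUP_emeasure_incseq[symmetric]) (auto simp: incseq_def)
    also have "\<dots> \<le> c"
      using f_cofinal(2) by (intro SUP_least) (auto simp: R_def)
    finally show ?thesis .
  qed
qed

lemma emeasure_le_if_AE_ccube_le:
  assumes "sets M = sets borel"
    and "AE y in M. y \<in> S \<longrightarrow> emeasure M (ccube x (infnorm (x - y))) \<le> c"
  shows "emeasure M S \<le> c"
proof (rule emeasure_le_if_AE_in_small_member[where B = "ccube x"])
  show "AE y in M. y \<in> S \<longrightarrow> (\<exists>r. y \<in> ccube x r \<and> emeasure M (ccube x r) \<le> c)"
    using assms(2) by eventually_elim (auto simp: mem_ccube)
qed (use assms(1) in \<open>simp_all add: ccube_mono_radius\<close>)

section \<open>The pointwise form of the \<open>A\<^sub>1\<close> condition\<close>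

definition ess_lower_bounds :: "'a measure \<Rightarrow> 'a set \<Rightarrow> ('a \<Rightarrow> real) \<Rightarrow> real set" where
  "ess_lower_bounds M Q u = {t. AE x in M. x \<in> Q \<longrightarrow> t \<le> u x}"

lemma AE_ess_lower_bounds_le:
  "AE x in M. x \<in> Q \<longrightarrow> (\<forall>t\<in>ess_lower_bounds M Q u. t \<le> u x)"
proof (cases "ess_lower_bounds M Q u = {}")
  case False
  then obtain f :: "nat \<Rightarrow> real" where f_cofinal: "range f \<subseteq> ess_lower_bounds M Q u"
    "\<forall>t\<in>ess_lower_bounds M Q u. \<exists>j. t \<le> f j"
    by (rule cofinal_sequence)
  have "AE x in M. \<forall>j. x \<in> Q \<longrightarrow> f j \<le> u x"
    using f_cofinal(1) unfolding AE_all_countable by (auto simp: ess_lower_bounds_def)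
  then show ?thesis
  proof eventually_elim
    case (elim x)
    then show ?case using f_cofinal(2) by (blast intro: order_trans)
  qed
qed simp

lemma cube_lebesgue: "cube Q \<Longrightarrow> Q \<in> sets lebesgue"
  by (erule cube_obtain_ccube) simp

lemma not_AE_notin_cube:
  assumes "cube Q"
  shows "\<not> (AE x in lebesgue. x \<notin> Q)"
proof
  assume "AE x in lebesgue. x \<notin> Q"
  then have "emeasure lebesgue Q = 0"
    using cube_lebesgue[OF assms] by (subst (asm) AE_iff_measurable[of Q]) auto
  then show False
    using assms by (auto elim!: cube_obtain_ccube simp: emeasure_ccube)
qed

lemma
  assumes "weight u" "cube Q"
  shows ess_inf_on_nonneg: "0 \<le> ess_inf_on Q u"
    and AE_ess_inf_on_le: "AE x in lebesgue. x \<in> Q \<longrightarrow> ess_inf_on Q u \<le> u x"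
proof -
  define T where "T = ess_lower_bounds lebesgue Q u"
  have ess_inf_eq: "ess_inf_on Q u = Sup T"
    by (simp add: T_def ess_lower_bounds_def ess_inf_on_def)
  have zero_lower: "0 \<in> T"
    using assms by (auto simp: T_def ess_lower_bounds_def weight_def elim: eventually_mono)
  have AE_lower: "AE x in lebesgue. x \<in> Q \<longrightarrow> (\<forall>t\<in>T. t \<le> u x)"
    unfolding T_def by (rule AE_ess_lower_bounds_le)
  then show "AE x in lebesgue. x \<in> Q \<longrightarrow> ess_inf_on Q u \<le> u x"
    using zero_lower by (auto simp: ess_inf_eq intro!: cSup_least elim!: eventually_mono)
  have "\<exists>x\<in>Q. \<forall>t\<in>T. t \<le> u x"
  proof (rule ccontr)
    assume unbounded: "\<not> ?thesis"
    have "AE x in lebesgue. x \<notin> Q"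
      using AE_lower by (rule eventually_mono) (use unbounded in metis)
    then show False using not_AE_notin_cube[OF \<open>cube Q\<close>] by contradiction
  qed
  then have "bdd_above T" by (auto simp: bdd_above_def)
  then show "0 \<le> ess_inf_on Q u"
    using zero_lower unfolding ess_inf_eq by (rule cSup_upper[rotated])
qed

lemma wmeas_mono:
  assumes "weight u" "cube Q" "cube Q'" "Q \<subseteq> Q'"
  shows "wmeas u Q \<le> wmeas u Q'"
  unfolding wmeas_def set_lebesgue_integral_def
proof (rule integral_mono_AE)
  have "AE x in lebesgue. 0 < u x" using assms by (simp add: weight_def)
  then show "AE x in lebesgue. indicator Q x *\<^sub>R u x \<le> indicator Q' x *\<^sub>R u x"
    by eventually_elim (use assms(4) in \<open>auto simp: indicator_def\<close>)
qed (use assms in \<open>auto simp: weight_def loc_int_def set_integrable_def\<close>)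

lemma wmeas_pos:
  assumes "weight u" "cube Q"
  shows "0 < wmeas u Q"
proof -
  have integrable: "integrable lebesgue (\<lambda>x. indicator Q x *\<^sub>R u x)"
    and u_pos: "AE x in lebesgue. 0 < u x"
    using assms by (simp_all add: weight_def loc_int_def set_integrable_def)
  have nonneg: "AE x in lebesgue. 0 \<le> indicator Q x *\<^sub>R u x"
    using u_pos by eventually_elim simp
  have "wmeas u Q \<noteq> 0"
  proof
    assume "wmeas u Q = 0"
    then have "AE x in lebesgue. indicator Q x *\<^sub>R u x = 0"
      using integral_nonneg_eq_0_iff_AE[OF integrable nonneg]
      by (simp add: wmeas_def set_lebesgue_integral_def)
    then have "AE x in lebesgue. x \<notin> Q"
      using u_pos by eventually_elim (auto simp: indicator_def split: if_splits)
    then show False using not_AE_notin_cube[OF \<open>cube Q\<close>] by contradiction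
  qed
  moreover have "0 \<le> wmeas u Q"
    unfolding wmeas_def set_lebesgue_integral_def by (rule integral_nonneg_AE[OF nonneg])
  ultimately show ?thesis by simp
qed

lemma A1_AE_avg_le:
  fixes u :: "'a::euclidean_space \<Rightarrow> real"
  assumes "A1 u"
  obtains C where "0 < C" "\<And>Q. cube Q \<Longrightarrow> AE x in lebesgue. x \<in> Q \<longrightarrow> avg u Q \<le> C * u x"
proof -
  obtain C where u_weight: "weight u" and avg_le: "\<And>Q. cube Q \<Longrightarrow> avg u Q \<le> C * ess_inf_on Q u"
    using assms by (auto simp: A1_def)
  have "AE x in lebesgue. x \<in> Q \<longrightarrow> avg u Q \<le> max C 1 * u x" if Q_cube: "cube Q" for Q
    using AE_ess_inf_on_le[OF u_weight Q_cube]
  proof eventually_elim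
    case (elim x)
    have "avg u Q \<le> max C 1 * ess_inf_on Q u"
      using ess_inf_on_nonneg[OF u_weight Q_cube]
      by (intro order_trans[OF avg_le[OF Q_cube] mult_right_mono]) auto
    also have "\<dots> \<le> max C 1 * u x" if "x \<in> Q"
      using elim that by (intro mult_left_mono) auto
    finally show ?case by blast
  qed
  then show ?thesis by (intro that[of "max C 1"]) auto
qed

text \<open>Enlarging each cube to one with rational radius and centre in a countable dense set makes the
  exceptional null set independent of the cube.\<close>
lemma A1_AE_wmeas_le:
  fixes u :: "'a::euclidean_space \<Rightarrow> real"
  assumes "A1 u"
  obtains C where "0 < C"
    "AE y in lebesgue. \<forall>x r. 0 < r \<longrightarrow> y \<in> ccube x r \<longrightarrow> wmeas u (ccube x r) \<le> C * r ^ DIM('a) * u y"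
proof -
  obtain C where C_pos: "0 < C" and avg_le: "\<And>Q. cube Q \<Longrightarrow> AE x in lebesgue. x \<in> Q \<longrightarrow> avg u Q \<le> C * u x"
    using A1_AE_avg_le[OF assms] by blast
  have u_weight: "weight u" using assms by (simp add: A1_def)
  obtain D :: "'a set" where D_dense: "countable D" "\<And>X. open X \<Longrightarrow> X \<noteq> {} \<Longrightarrow> \<exists>d\<in>D. d \<in> X"
    using countable_dense_setE by blast
  have "AE y in lebesgue. \<forall>q\<in>D. \<forall>r\<in>\<rat>. 0 < r \<longrightarrow> y \<in> ccube q r \<longrightarrow> avg u (ccube q r) \<le> C * u y"
    by (intro AE_ball_countable'[OF _ D_dense(1)] AE_ball_countable'[OF _ countable_rat] AE_impI
        avg_le cube_ccube)
  moreover have "AE y in lebesgue. 0 < u y" using u_weight by (simp add: weight_def)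
  ultimately have "AE y in lebesgue. \<forall>x r. 0 < r \<longrightarrow> y \<in> ccube x r \<longrightarrow>
    wmeas u (ccube x r) \<le> (C * 6 ^ DIM('a)) * r ^ DIM('a) * u y"
  proof eventually_elim
    case (elim y)
    show ?case
    proof (intro allI impI)
      fix x and r :: real assume r_pos_mem: "0 < r" "y \<in> ccube x r"
      obtain q where q_near: "q \<in> D" "q \<in> ball x r" using D_dense(2)[of "ball x r"] r_pos_mem by auto
      obtain r' where r'_rational: "r' \<in> \<rat>" "2 * r < r'" "r' < 3 * r"
        using Rats_dense_in_real[of "2 * r" "3 * r"] r_pos_mem by auto
      have "infnorm (x - q) \<le> r"
        using q_near infnorm_le_norm[of "x - q"] by (simp add: dist_norm)
      then have ccube_subset: "ccube x r \<subseteq> ccube q r'" using r'_rational by (intro ccube_mono) auto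
      then have avg_le_u: "avg u (ccube q r') \<le> C * u y" using elim q_near r'_rational r_pos_mem by auto
      have "wmeas u (ccube x r) \<le> wmeas u (ccube q r')"
        using r_pos_mem r'_rational ccube_subset by (intro wmeas_mono u_weight cube_ccube) auto
      also have "\<dots> \<le> C * u y * (2 * r') ^ DIM('a)"
        using avg_le_u r_pos_mem r'_rational by (simp add: avg_def measure_ccube field_simps)
      also have "\<dots> \<le> C * u y * (6 * r) ^ DIM('a)"
        using r_pos_mem r'_rational elim C_pos by (intro mult_left_mono power_mono) auto
      finally show "wmeas u (ccube x r) \<le> (C * 6 ^ DIM('a)) * r ^ DIM('a) * u y"
        by (simp add: power_mult_distrib mult_ac)
    qed
  qed
  then show ?thesis using C_pos by (intro that[of "C * 6 ^ DIM('a)"]) auto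
qed

section \<open>Weighted Morrey spaces\<close>

lemma set_nn_integral_eq_set_integral:
  fixes g :: "'a::euclidean_space \<Rightarrow> real"
  assumes nonneg: "AE x in lebesgue. 0 \<le> g x" and integrable: "set_integrable lebesgue Q g"
  shows "(\<integral>\<^sup>+x\<in>Q. ennreal (g x) \<partial>lborel) = ennreal (LINT x:Q|lebesgue. g x)"
proof -
  have "(\<integral>\<^sup>+x\<in>Q. ennreal (g x) \<partial>lborel) = (\<integral>\<^sup>+x. ennreal (indicator Q x *\<^sub>R g x) \<partial>lebesgue)"
    unfolding nn_integral_completion by (intro nn_integral_cong) (simp add: indicator_def)
  also have "\<dots> = ennreal (LINT x:Q|lebesgue. g x)"
    unfolding set_lebesgue_integral_def using integrable nonneg
    by (intro nn_integral_eq_integral) (auto simp: set_integrable_def elim: eventually_mono)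
  finally show ?thesis .
qed

lemma morrey_norm_nonneg:
  fixes f :: "'a::euclidean_space \<Rightarrow> real"
  assumes "morrey_space p \<kappa> u v f"
  shows "0 \<le> morrey_norm p \<kappa> u v f"
proof -
  have "morrey_quot p \<kappa> u v f (ccube 0 1) \<le> morrey_norm p \<kappa> u v f"
    unfolding morrey_norm_def using assms cube_ccube[of 1 "0::'a"]
    by (intro cSUP_upper) (auto simp: morrey_space_def)
  then show ?thesis by (rule order_trans[rotated]) (simp add: morrey_quot_def)
qed

lemma morrey_space_nn_integral_le:
  fixes f u v :: "'a::euclidean_space \<Rightarrow> real"
  assumes f_morrey: "morrey_space p \<kappa> u v f" and p_pos: "0 < p" and u_nonneg: "\<And>x. 0 \<le> u x"
    and Q_cube: "cube Q" "0 < wmeas v Q"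
  shows "(\<integral>\<^sup>+x\<in>Q. ennreal (\<bar>f x\<bar> powr p * u x) \<partial>lborel)
    \<le> ennreal (morrey_norm p \<kappa> u v f powr p * wmeas v Q powr \<kappa>)"
proof -
  define I where "I = (LINT x:Q|lebesgue. \<bar>f x\<bar> powr p * u x)"
  define q where "q = 1 / wmeas v Q powr \<kappa> * I"
  have "0 \<le> I"
    unfolding I_def set_lebesgue_integral_def using u_nonneg
    by (intro Bochner_Integration.integral_nonneg) simp
  then have "0 \<le> q" by (simp add: q_def)
  have "q powr (1 / p) \<le> morrey_norm p \<kappa> u v f"
    unfolding morrey_norm_def q_def I_def morrey_quot_def[symmetric] using f_morrey Q_cube
    by (intro cSUP_upper) (auto simp: morrey_space_def)
  then have "(q powr (1 / p)) powr p \<le> morrey_norm p \<kappa> u v f powr p"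
    using p_pos by (intro powr_mono2) auto
  then have "I \<le> morrey_norm p \<kappa> u v f powr p * wmeas v Q powr \<kappa>"
    using p_pos Q_cube \<open>0 \<le> q\<close> by (simp add: powr_powr q_def field_simps)
  then show ?thesis
    using f_morrey Q_cube u_nonneg
    by (subst set_nn_integral_eq_set_integral) (auto simp: morrey_space_def I_def intro: ennreal_leI)
qed

lemma morrey_spaceI:
  fixes f u v :: "'a::euclidean_space \<Rightarrow> real"
  assumes f_measurable: "f \<in> borel_measurable lebesgue"
    and u_nonneg_measurable: "u \<in> borel_measurable lebesgue" "\<And>x. 0 \<le> u x"
    and p_pos: "0 < p" and N_nonneg: "0 \<le> N" and v_pos: "\<And>Q. cube Q \<Longrightarrow> 0 < wmeas v Q"
    and power_le: "\<And>Q. cube Q \<Longrightarrow>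
      (\<integral>\<^sup>+x\<in>Q. ennreal (\<bar>f x\<bar> powr p * u x) \<partial>lborel) \<le> ennreal (N powr p * wmeas v Q powr \<kappa>)"
  shows "morrey_space p \<kappa> u v f" "morrey_norm p \<kappa> u v f \<le> N"
proof -
  have integrable: "set_integrable lebesgue Q (\<lambda>x. \<bar>f x\<bar> powr p * u x)" if Q_cube: "cube Q" for Q
    unfolding set_integrable_def
  proof (rule integrableI_nonneg)
    show "(\<lambda>x. indicator Q x *\<^sub>R (\<bar>f x\<bar> powr p * u x)) \<in> borel_measurable lebesgue"
      using f_measurable u_nonneg_measurable(1) cube_lebesgue[OF Q_cube]
      by (intro borel_measurable_scaleR borel_measurable_times powr_real_measurable
          borel_measurable_abs borel_measurable_indicator) auto
    have "(\<integral>\<^sup>+x. ennreal (indicator Q x *\<^sub>R (\<bar>f x\<bar> powr p * u x)) \<partial>lebesgue)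
        = (\<integral>\<^sup>+x\<in>Q. ennreal (\<bar>f x\<bar> powr p * u x) \<partial>lborel)"
      unfolding nn_integral_completion by (intro nn_integral_cong) (simp add: indicator_def)
    also have "\<dots> < \<infinity>" using power_le[OF Q_cube] by (rule order.strict_trans1) simp
    finally show "(\<integral>\<^sup>+x. ennreal (indicator Q x *\<^sub>R (\<bar>f x\<bar> powr p * u x)) \<partial>lebesgue) < \<infinity>" .
  qed (use u_nonneg_measurable(2) in auto)
  have quot_le: "morrey_quot p \<kappa> u v f Q \<le> N" if Q_cube: "cube Q" for Q
  proof -
    define I where "I = (LINT x:Q|lebesgue. \<bar>f x\<bar> powr p * u x)"
    have "0 \<le> I"
      unfolding I_def set_lebesgue_integral_def using u_nonneg_measurable
      by (intro Bochner_Integration.integral_nonneg) simp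
    have "ennreal I \<le> ennreal (N powr p * wmeas v Q powr \<kappa>)"
      using power_le[OF Q_cube] u_nonneg_measurable(2) integrable[OF Q_cube]
      by (subst (asm) set_nn_integral_eq_set_integral) (auto simp: I_def)
    then have "1 / wmeas v Q powr \<kappa> * I \<le> N powr p"
      using v_pos[OF Q_cube] by (simp add: field_simps)
    then have "morrey_quot p \<kappa> u v f Q \<le> (N powr p) powr (1 / p)"
      unfolding morrey_quot_def I_def[symmetric] using p_pos \<open>0 \<le> I\<close> by (intro powr_mono2) auto
    also have "\<dots> = N" using p_pos N_nonneg by (simp add: powr_powr)
    finally show ?thesis .
  qed
  show "morrey_space p \<kappa> u v f"
    using f_measurable integrable quot_le unfolding morrey_space_def by (auto intro!: bdd_aboveI2)
  show "morrey_norm p \<kappa> u v f \<le> N"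
    unfolding morrey_norm_def using quot_le by (intro cSUP_least cubes_nonempty) auto
qed

lemma morrey_space_dominated:
  fixes g u v :: "'a::euclidean_space \<Rightarrow> real"
  assumes g_measurable: "g \<in> borel_measurable lebesgue"
    and u_nonneg_measurable: "u \<in> borel_measurable lebesgue" "\<And>x. 0 \<le> u x"
    and p_pos: "0 < p" and "0 \<le> K" "0 \<le> N" and v_pos: "\<And>Q. cube Q \<Longrightarrow> 0 < wmeas v Q"
    and dominated: "AE x in lebesgue. ennreal \<bar>g x\<bar> \<le> ennreal K * G x"
    and power_le: "\<And>Q. cube Q \<Longrightarrow>
      (\<integral>\<^sup>+x\<in>Q. G x epowr p * ennreal (u x) \<partial>lborel) \<le> ennreal (N powr p * wmeas v Q powr \<kappa>)"
    and G_measurable: "G \<in> borel_measurable lborel"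
  shows "morrey_space p \<kappa> u v g" "morrey_norm p \<kappa> u v g \<le> K * N"
proof -
  have bound: "(\<integral>\<^sup>+x\<in>Q. ennreal (\<bar>g x\<bar> powr p * u x) \<partial>lborel)
      \<le> ennreal ((K * N) powr p * wmeas v Q powr \<kappa>)"
    if Q_cube: "cube Q" for Q
  proof -
    have "(\<integral>\<^sup>+x\<in>Q. ennreal (\<bar>g x\<bar> powr p * u x) \<partial>lborel)
        \<le> (\<integral>\<^sup>+x. ennreal (K powr p) * (G x epowr p * ennreal (u x) * indicator Q x) \<partial>lebesgue)"
      unfolding nn_integral_completion[of lborel, symmetric]
    proof (rule nn_integral_mono_AE, use dominated in eventually_elim)
      case (elim x)
      have "ennreal (\<bar>g x\<bar> powr p) \<le> ennreal (K powr p) * G x epowr p"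
        using epowr_mono[OF elim, of p] p_pos \<open>0 \<le> K\<close> by (simp add: epowr_mult)
      then have "ennreal (\<bar>g x\<bar> powr p) * ennreal (u x)
          \<le> ennreal (K powr p) * G x epowr p * ennreal (u x)"
        by (rule mult_right_mono) simp
      then show ?case
        using u_nonneg_measurable(2)[of x] by (simp add: ennreal_mult mult.assoc indicator_def)
    qed
    also have "\<dots> = ennreal (K powr p) * (\<integral>\<^sup>+x\<in>Q. G x epowr p * ennreal (u x) \<partial>lborel)"
      unfolding nn_integral_completion[of lborel, symmetric]
      using G_measurable[THEN measurable_completion] u_nonneg_measurable(1) cube_lebesgue[OF Q_cube]
      by (intro nn_integral_cmult borel_measurable_times_ennreal borel_measurable_epowr
          measurable_compose[OF u_nonneg_measurable(1) measurable_ennreal] borel_measurable_indicator)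
    also have "\<dots> \<le> ennreal (K powr p) * ennreal (N powr p * wmeas v Q powr \<kappa>)"
      by (intro mult_left_mono power_le Q_cube) simp
    also have "\<dots> = ennreal ((K * N) powr p * wmeas v Q powr \<kappa>)"
      using assms by (simp add: ennreal_mult[symmetric] powr_mult mult.assoc)
    finally show ?thesis .
  qed
  have KN_nonneg: "0 \<le> K * N" using assms by simp
  show "morrey_space p \<kappa> u v g"
    by (rule morrey_spaceI[OF g_measurable u_nonneg_measurable p_pos KN_nonneg v_pos bound])
  show "morrey_norm p \<kappa> u v g \<le> K * N"
    by (rule morrey_spaceI[OF g_measurable u_nonneg_measurable p_pos KN_nonneg v_pos bound])
qed

lemma weight_borel_representative:
  fixes v :: "'a::euclidean_space \<Rightarrow> real"
  assumes "weight v"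
  obtains u where "u \<in> borel_measurable borel" "\<And>x. 0 < u x" "AE x in lborel. v x = u x"
    "\<And>Q. cube Q \<Longrightarrow> emeasure (density lborel (\<lambda>x. ennreal (u x))) Q = ennreal (wmeas v Q)"
proof -
  have v_pos: "AE x in lborel. 0 < v x"
    using assms by (simp add: weight_def AE_completion_iff)
  obtain v' where [measurable]: "v' \<in> borel_measurable borel" and v_eq_v': "AE x in lborel. v x = v' x"
    using completion_ex_borel_measurable_real[of v lborel] assms by (auto simp: weight_def loc_int_def)
  define u where "u x = (if 0 < v' x then v' x else 1)" for x
  have u_measurable [measurable]: "u \<in> borel_measurable borel" unfolding u_def by measurable
  have u_eq: "AE x in lborel. v x = u x"
    using v_eq_v' v_pos by eventually_elim (simp add: u_def)
  have "emeasure (density lborel (\<lambda>x. ennreal (u x))) Q = ennreal (wmeas v Q)" if Q_cube: "cube Q" for Q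
  proof -
    have "Q \<in> sets borel" using Q_cube by (auto simp: cube_def)
    then have "emeasure (density lborel (\<lambda>x. ennreal (u x))) Q = (\<integral>\<^sup>+x\<in>Q. ennreal (u x) \<partial>lborel)"
      by (subst emeasure_density) auto
    also have "\<dots> = (\<integral>\<^sup>+x\<in>Q. ennreal (v x) \<partial>lborel)"
      using u_eq by (intro nn_integral_cong_AE) (auto elim: eventually_mono)
    also have "\<dots> = ennreal (wmeas v Q)"
      unfolding wmeas_def using assms Q_cube
      by (intro set_nn_integral_eq_set_integral)
        (auto simp: weight_def loc_int_def elim: eventually_mono)
    finally show ?thesis .
  qed
  then show thesis using u_measurable u_eq by (intro that[of u]) (auto simp: u_def)
qed

section \<open>The Riesz potential on weighted Morrey spaces\<close>

text \<open>The supremum norm is comparable to the Euclidean one, and its balls are cubes.\<close>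
definition riesz_potential :: "real \<Rightarrow> ('a::euclidean_space \<Rightarrow> real) \<Rightarrow> 'a \<Rightarrow> ennreal" where
  "riesz_potential \<gamma> f x = (\<integral>\<^sup>+y. ennreal (\<bar>f y\<bar> * infnorm (x - y) powr (\<gamma> - real DIM('a))) \<partial>lborel)"

lemma riesz_potential_cong_AE:
  assumes "AE y in lborel. f y = g y"
  shows "riesz_potential \<gamma> f = riesz_potential \<gamma> g"
  unfolding riesz_potential_def using assms
  by (intro ext nn_integral_cong_AE) (auto elim: eventually_mono)

lemma riesz_potential_measurable:
  assumes "f \<in> borel_measurable lebesgue"
  shows "riesz_potential \<gamma> f \<in> borel_measurable lborel"
proof -
  obtain f' where [measurable]: "f' \<in> borel_measurable borel" and f_eq_f': "AE x in lborel. f x = f' x"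
    using completion_ex_borel_measurable_real[of f lborel] assms by auto
  have "riesz_potential \<gamma> f' \<in> borel_measurable lborel"
    unfolding riesz_potential_def[abs_def] by measurable
  then show ?thesis by (simp add: riesz_potential_cong_AE[OF f_eq_f'])
qed

locale pointwise_A1 =
  fixes u :: "'a::euclidean_space \<Rightarrow> real" and A :: real
  assumes u_measurable [measurable]: "u \<in> borel_measurable borel"
    and u_pos: "0 < u x"
    and A_pos: "0 < A"
    and A1_AE: "AE y in lborel. \<forall>x r. 0 < r \<longrightarrow> y \<in> ccube x r \<longrightarrow>
      emeasure (density lborel (\<lambda>x. ennreal (u x))) (ccube x r) \<le> ennreal (A * r ^ DIM('a) * u y)"
begin

definition \<mu> :: "'a measure" where "\<mu> = density lborel (\<lambda>x. ennreal (u x))"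

definition \<psi> :: "'a \<Rightarrow> 'a \<Rightarrow> real" where "\<psi> x y = infnorm (x - y) ^ DIM('a) * u y"

lemma sets_\<mu> [measurable_cong, simp]: "sets \<mu> = sets borel"
  by (simp add: \<mu>_def)

lemma space_\<mu> [simp]: "space \<mu> = UNIV"
  by (simp add: \<mu>_def)

lemma u_nonneg [simp]: "0 \<le> u x"
  using u_pos[of x] by simp

lemma \<psi>_nonneg: "0 \<le> \<psi> x y"
  by (simp add: \<psi>_def infnorm_pos_le)

lemma \<psi>_measurable [measurable]: "case_prod \<psi> \<in> borel_measurable (borel \<Otimes>\<^sub>M borel)"
  unfolding \<psi>_def by measurable

lemma AE_\<mu>I: "AE x in lborel. P x \<Longrightarrow> AE x in \<mu>. P x"
  unfolding \<mu>_def by (subst AE_density) (auto elim: eventually_mono)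

lemma emeasure_\<mu>_finite: "emeasure \<mu> (ccube x r) < \<infinity>"
proof -
  obtain y where y_bound: "\<And>x r. 0 < r \<Longrightarrow> y \<in> ccube x r \<Longrightarrow>
      emeasure \<mu> (ccube x r) \<le> ennreal (A * r ^ DIM('a) * u y)"
    using eventually_happens'[OF _ A1_AE] by (auto simp: \<mu>_def ae_filter_eq_bot_iff)
  define R where "R = infnorm (x - y) + \<bar>r\<bar> + 1"
  have "emeasure \<mu> (ccube x r) \<le> emeasure \<mu> (ccube x R)"
    using infnorm_pos_le[of "x - y"] by (intro emeasure_mono ccube_mono_radius) (simp_all add: R_def)
  also have "\<dots> \<le> ennreal (A * R ^ DIM('a) * u y)"
    by (intro y_bound) (simp_all add: R_def mem_ccube infnorm_pos_le add_nonneg_pos)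
  finally show ?thesis by (rule order.strict_trans1) simp
qed

lemma emeasure_\<mu>: "emeasure \<mu> (ccube x r) = ennreal (measure \<mu> (ccube x r))"
  using emeasure_\<mu>_finite[of x r] by (subst emeasure_eq_ennreal_measure) auto

lemma measure_\<mu>_mono: "ccube x r \<subseteq> ccube z R \<Longrightarrow> measure \<mu> (ccube x r) \<le> measure \<mu> (ccube z R)"
  using emeasure_\<mu>_finite[of z R] by (intro measure_mono_fmeasurable) (auto simp: fmeasurable_def)

lemma AE_measure_\<mu>_le:
  "AE y in lborel. \<forall>x r. 0 < r \<longrightarrow> y \<in> ccube x r \<longrightarrow> measure \<mu> (ccube x r) \<le> A * r ^ DIM('a) * u y"
  using A1_AE
proof eventually_elim
  case (elim y)
  have "0 \<le> A * r ^ DIM('a) * u y" if "0 < r" for r using that A_pos by simp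
  then show ?case using elim by (auto simp: \<mu>_def[symmetric] emeasure_\<mu> simp del: zero_le_mult_iff)
qed

lemma AE_measure_\<mu>_le_\<psi>:
  "AE y in lborel. \<forall>x. x \<noteq> y \<longrightarrow>
    measure \<mu> (ccube x (infnorm (x - y))) \<le> A * \<psi> x y \<and>
    measure \<mu> (ccube y (infnorm (x - y))) \<le> A * \<psi> x y"
  using AE_measure_\<mu>_le
proof eventually_elim
  case (elim y)
  show ?case
  proof (intro allI impI)
    fix x assume "x \<noteq> y"
    then have dist_pos: "0 < infnorm (x - y)" by (simp add: infnorm_pos_lt)
    then have "y \<in> ccube x (infnorm (x - y))" "y \<in> ccube y (infnorm (x - y))"
      by (simp_all add: mem_ccube infnorm_0)
    then show "measure \<mu> (ccube x (infnorm (x - y))) \<le> A * \<psi> x y \<and>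
        measure \<mu> (ccube y (infnorm (x - y))) \<le> A * \<psi> x y"
      using elim dist_pos by (simp add: \<psi>_def mult.assoc)
  qed
qed

lemma measure_\<mu>_pos:
  assumes "0 < r"
  shows "0 < measure \<mu> (ccube x r)"
proof -
  have "emeasure \<mu> (ccube x r) \<noteq> 0"
  proof
    assume "emeasure \<mu> (ccube x r) = 0"
    then have "AE y in lborel. ennreal (u y) * indicator (ccube x r) y = 0"
      by (simp add: \<mu>_def emeasure_density nn_integral_0_iff_AE)
    then have "AE y in lborel. y \<notin> ccube x r"
    proof eventually_elim
      case (elim y)
      then show ?case using u_pos[of y] by (auto simp: indicator_def ennreal_eq_0_iff)
    qed
    then show False
      using not_AE_notin_cube[OF cube_ccube[OF assms]] by (blast intro: AE_completion)
  qed
  then show ?thesis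
    using emeasure_\<mu>[of x r] by (simp add: zero_less_measure_iff)
qed

lemma measure_\<mu>_ccube_le:
  assumes r_range: "0 < r" "r \<le> R"
  shows "measure \<mu> (ccube z R) \<le> A * (R / (2 * r)) ^ DIM('a) * measure \<mu> (ccube z r)"
proof -
  have "AE y in lborel. ennreal (measure \<mu> (ccube z R)) * indicator (ccube z r) y
      \<le> ennreal (A * R ^ DIM('a)) * (ennreal (u y) * indicator (ccube z r) y)"
    using AE_measure_\<mu>_le
  proof eventually_elim
    case (elim y)
    have "measure \<mu> (ccube z R) \<le> A * R ^ DIM('a) * u y" if "y \<in> ccube z r"
      using elim[rule_format, of R z] r_range ccube_mono_radius[OF r_range(2), of z] that by auto
    then show ?case
      using A_pos r_range by (auto simp: indicator_def ennreal_mult[symmetric] intro!: ennreal_leI)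
  qed
  then have "(\<integral>\<^sup>+y. ennreal (measure \<mu> (ccube z R)) * indicator (ccube z r) y \<partial>lborel)
      \<le> (\<integral>\<^sup>+y. ennreal (A * R ^ DIM('a)) * (ennreal (u y) * indicator (ccube z r) y) \<partial>lborel)"
    by (rule nn_integral_mono_AE)
  then have "ennreal (measure \<mu> (ccube z R)) * ennreal ((2 * r) ^ DIM('a))
      \<le> ennreal (A * R ^ DIM('a)) * emeasure \<mu> (ccube z r)"
    using r_range by (simp add: nn_integral_cmult emeasure_ccube \<mu>_def emeasure_density)
  then have "measure \<mu> (ccube z R) * (2 * r) ^ DIM('a) \<le> A * R ^ DIM('a) * measure \<mu> (ccube z r)"
    using r_range A_pos by (simp add: emeasure_\<mu> ennreal_mult[symmetric])
  then show ?thesis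
    using r_range by (simp add: power_divide field_simps)
qed

lemma AE_mem_ccube_triple:
  assumes R_pos: "0 < R"
  shows "AE y in \<mu>. \<forall>x\<in>ccube z R. \<psi> x y < measure \<mu> (ccube z R) / A \<longrightarrow> y \<in> ccube z (3 * R)"
proof (rule AE_\<mu>I, use AE_measure_\<mu>_le_\<psi> in eventually_elim)
  case (elim y)
  show ?case
  proof (intro ballI impI, rule ccontr)
    fix x assume x_near: "x \<in> ccube z R" "\<psi> x y < measure \<mu> (ccube z R) / A"
      and y_notin: "y \<notin> ccube z (3 * R)"
    have "infnorm (z - y) \<le> infnorm (z - x) + infnorm (x - y)"
      using infnorm_triangle[of "z - x" "x - y"] by simp
    then have dist_gt: "2 * R < infnorm (x - y)" using x_near(1) y_notin by (simp add: mem_ccube)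
    then have "measure \<mu> (ccube z R) \<le> measure \<mu> (ccube x (infnorm (x - y)))"
      using x_near(1) by (intro measure_\<mu>_mono ccube_mono) (simp add: mem_ccube)
    also have "\<dots> \<le> A * \<psi> x y"
      using elim[rule_format, of x] dist_gt R_pos by (cases "x = y") (auto simp: infnorm_0)
    finally show False using x_near(2) A_pos by (simp add: field_simps)
  qed
qed

lemma emeasure_density_\<psi>_sublevel_right:
  assumes g_measurable [measurable]: "g \<in> borel_measurable borel"
    and ccube_le: "\<And>r. 0 < r \<Longrightarrow>
      emeasure (density lborel g) (ccube x r) \<le> ennreal (K * measure \<mu> (ccube x r) powr k)"
    and "0 \<le> k" "0 \<le> K"
  shows "emeasure (density lborel g) {y. \<psi> x y < t} \<le> ennreal (K * (A * t) powr k)"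
proof (rule emeasure_le_if_AE_ccube_le[where x = x])
  have "AE y in lborel. \<psi> x y < t \<longrightarrow>
      emeasure (density lborel g) (ccube x (infnorm (x - y))) \<le> ennreal (K * (A * t) powr k)"
    using AE_measure_\<mu>_le_\<psi> AE_lborel_singleton[of x]
  proof eventually_elim
    case (elim y)
    show ?case
    proof
      assume "\<psi> x y < t"
      have "measure \<mu> (ccube x (infnorm (x - y))) \<le> A * \<psi> x y" using elim by auto
      also have "\<dots> \<le> A * t" using \<open>\<psi> x y < t\<close> A_pos by simp
      finally have "K * measure \<mu> (ccube x (infnorm (x - y))) powr k \<le> K * (A * t) powr k"
        using assms by (intro mult_left_mono powr_mono2) auto
      then show "emeasure (density lborel g) (ccube x (infnorm (x - y))) \<le> ennreal (K * (A * t) powr k)"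
        using elim by (intro order_trans[OF ccube_le ennreal_leI]) (auto simp: infnorm_pos_lt)
    qed
  qed
  then show "AE y in density lborel g. y \<in> {y. \<psi> x y < t} \<longrightarrow>
      emeasure (density lborel g) (ccube x (infnorm (x - y))) \<le> ennreal (K * (A * t) powr k)"
    by (subst AE_density) (auto elim: eventually_mono)
qed simp

lemma emeasure_\<mu>_sublevel_right:
  assumes "0 < t"
  shows "emeasure \<mu> {y. \<psi> x y < t} \<le> ennreal (A * t)"
  using emeasure_density_\<psi>_sublevel_right[of "\<lambda>y. ennreal (u y)" x 1 1 t] assms A_pos
  by (simp add: \<mu>_def[symmetric] emeasure_\<mu>)

lemma emeasure_\<mu>_sublevel_left:
  "AE y in \<mu>. \<forall>t>0. emeasure \<mu> {x. \<psi> x y < t} \<le> ennreal (A * t)"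
proof (rule AE_\<mu>I, use AE_measure_\<mu>_le_\<psi> in eventually_elim)
  case (elim y)
  have "emeasure \<mu> (ccube y (infnorm (y - x))) \<le> ennreal (A * t)" if "x \<noteq> y" "\<psi> x y < t" for x t
  proof -
    have "measure \<mu> (ccube y (infnorm (x - y))) \<le> A * \<psi> x y" using elim that by blast
    also have "\<dots> \<le> A * t" using that A_pos by simp
    finally show ?thesis by (simp add: emeasure_\<mu> ennreal_leI infnorm_sub)
  qed
  then have "AE x in \<mu>. x \<in> {x. \<psi> x y < t} \<longrightarrow> emeasure \<mu> (ccube y (infnorm (y - x))) \<le> ennreal (A * t)"
    for t
    using AE_\<mu>I[OF AE_lborel_singleton[of y]] by (auto elim: eventually_mono)
  then show ?case
    by (intro allI impI emeasure_le_if_AE_ccube_le[where x = y]) simp_all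
qed

end

lemma A1_borel_representative:
  fixes v :: "'a::euclidean_space \<Rightarrow> real"
  assumes "A1 v"
  obtains u A where "pointwise_A1 u A" "AE x in lborel. v x = u x"
    "\<And>Q. cube Q \<Longrightarrow> emeasure (density lborel (\<lambda>x. ennreal (u x))) Q = ennreal (wmeas v Q)"
proof -
  have "weight v" using assms by (simp add: A1_def)
  then obtain u where u_borel: "u \<in> borel_measurable borel" "\<And>x. 0 < u x" "AE x in lborel. v x = u x"
    and u_wmeas: "\<And>Q. cube Q \<Longrightarrow> emeasure (density lborel (\<lambda>x. ennreal (u x))) Q = ennreal (wmeas v Q)"
    by (rule weight_borel_representative) blast
  obtain A where A_pos: "0 < A" and wmeas_le: "AE y in lebesgue. \<forall>x r. 0 < r \<longrightarrow> y \<in> ccube x r \<longrightarrow>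
      wmeas v (ccube x r) \<le> A * r ^ DIM('a) * v y"
    using A1_AE_wmeas_le[OF assms] by blast
  have "AE y in lborel. \<forall>x r. 0 < r \<longrightarrow> y \<in> ccube x r \<longrightarrow>
      emeasure (density lborel (\<lambda>x. ennreal (u x))) (ccube x r) \<le> ennreal (A * r ^ DIM('a) * u y)"
    using wmeas_le[unfolded AE_completion_iff] u_borel(3)
    by eventually_elim (auto simp: u_wmeas cube_ccube intro!: ennreal_leI)
  then have "pointwise_A1 u A" using u_borel A_pos by unfold_locales auto
  then show thesis using u_borel(3) u_wmeas by (rule that)
qed

locale pointwise_A1_morrey = pointwise_A1 u A
  for u :: "'a::euclidean_space \<Rightarrow> real" and A :: real +
  fixes p s \<kappa> \<gamma> :: real
  assumes \<gamma>_pos: "0 < \<gamma>" and p_gt_1: "1 < p" and s_pos: "0 < s"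
    and s_eq: "1 / s = 1 / p - \<gamma> / real DIM('a)"
    and \<kappa>_range: "0 < \<kappa>" "\<kappa> < p / s"
begin

lemma p_less_s: "p < s"
proof -
  have "1 / s < 1 / p" using \<gamma>_pos s_eq by simp
  then show ?thesis using p_gt_1 s_pos by (simp add: field_simps)
qed

sublocale growth_kernel \<mu> \<psi> A p s \<kappa>
proof
  have "sigma_finite_measure \<mu>"
    unfolding \<mu>_def using lborel.sigma_finite_measure_axioms
    by (subst sigma_finite_measure.sigma_finite_iff_density_finite) auto
  then show "\<exists>A. countable A \<and> A \<subseteq> sets \<mu> \<and> \<Union> A = space \<mu> \<and> (\<forall>a\<in>A. emeasure \<mu> a \<noteq> \<infinity>)"
    by (rule sigma_finite_measure.sigma_finite_countable)
qed (use \<psi>_nonneg A_pos emeasure_\<mu>_sublevel_right emeasure_\<mu>_sublevel_left p_gt_1 p_less_s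
    \<kappa>_range in auto)

text \<open>The substitution \<open>\<bar>f\<bar> = h u\<^bsup>\<gamma>/n\<^esup>\<close> turns the Riesz kernel into a power of
  \<open>\<psi>\<close>, integrated against \<open>\<mu>\<close>.\<close>
definition density_ratio :: "('a \<Rightarrow> real) \<Rightarrow> 'a \<Rightarrow> real" where
  "density_ratio f y = \<bar>f y\<bar> * u y powr - (\<gamma> / real DIM('a))"

lemma density_ratio_measurable [measurable]:
  assumes [measurable]: "f \<in> borel_measurable borel"
  shows "density_ratio f \<in> borel_measurable borel"
  unfolding density_ratio_def[abs_def] by measurable

lemma \<theta>_eq: "\<theta> = 1 - \<gamma> / real DIM('a)"
  by (simp add: \<theta>_def s_eq)

lemma riesz_potential_eq_potential:
  assumes [measurable]: "f \<in> borel_measurable borel"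
  shows "riesz_potential \<gamma> f x = potential (density_ratio f) x"
proof -
  have kernel: "\<bar>f y\<bar> * infnorm (x - y) powr (\<gamma> - real DIM('a))
      = u y * (density_ratio f y * \<psi> x y powr - \<theta>)" for y
  proof -
    have "\<psi> x y powr - \<theta> = infnorm (x - y) powr (real DIM('a) * - \<theta>) * u y powr - \<theta>"
      by (cases "x = y")
        (simp_all add: \<psi>_def powr_mult infnorm_0 infnorm_pos_lt powr_realpow[symmetric] powr_powr)
    also have "real DIM('a) * - \<theta> = \<gamma> - real DIM('a)"
      by (simp add: \<theta>_eq right_diff_distrib)
    finally have \<psi>_powr: "\<psi> x y powr - \<theta> = infnorm (x - y) powr (\<gamma> - real DIM('a)) * u y powr - \<theta>" .
    have "u y powr 1 * (u y powr - (\<gamma> / real DIM('a)) * u y powr - \<theta>) = 1"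
      unfolding powr_add[symmetric] using u_pos[of y] by (simp add: \<theta>_eq)
    then have "u y * (u y powr - (\<gamma> / real DIM('a)) * u y powr - \<theta>) = 1" by simp
    then show ?thesis by (simp add: density_ratio_def \<psi>_powr mult_ac)
  qed
  have "(\<integral>\<^sup>+y. ennreal (density_ratio f y * \<psi> x y powr - \<theta>) \<partial>\<mu>)
      = (\<integral>\<^sup>+y. ennreal (u y * (density_ratio f y * \<psi> x y powr - \<theta>)) \<partial>lborel)"
    unfolding \<mu>_def by (subst nn_integral_density) (auto simp: ennreal_mult')
  then show ?thesis
    by (simp add: riesz_potential_def potential_def kernel)
qed

lemma power_measure_density_ratio:
  assumes [measurable]: "f \<in> borel_measurable borel"
  shows "power_measure (density_ratio f)
      = density lborel (\<lambda>y. ennreal (\<bar>f y\<bar> powr p * u y powr (p / s)))"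
proof -
  have "u y * density_ratio f y powr p = \<bar>f y\<bar> powr p * u y powr (p / s)" for y
  proof -
    have "p / s = 1 - p * (\<gamma> / real DIM('a))"
      using s_eq p_gt_1 by (simp add: field_simps)
    then have "u y powr (p / s) = u y * u y powr (- (\<gamma> / real DIM('a)) * p)"
      using u_pos[of y] by (simp add: powr_diff powr_minus divide_inverse mult.commute)
    then show ?thesis by (simp add: density_ratio_def powr_mult powr_powr)
  qed
  then have "density \<mu> (\<lambda>y. ennreal (density_ratio f y powr p))
      = density lborel (\<lambda>y. ennreal (\<bar>f y\<bar> powr p * u y powr (p / s)))"
    unfolding \<mu>_def by (subst density_density_eq) (auto simp: ennreal_mult'[symmetric])
  then show ?thesis by (simp add: power_measure_def)
qed

definition morrey_bound :: "('a \<Rightarrow> real) \<Rightarrow> real \<Rightarrow> bool" where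
  "morrey_bound f N \<longleftrightarrow> f \<in> borel_measurable borel \<and> 0 \<le> N \<and>
    (\<forall>x r. 0 < r \<longrightarrow> (\<integral>\<^sup>+y\<in>ccube x r. ennreal (\<bar>f y\<bar> powr p * u y powr (p / s)) \<partial>lborel)
      \<le> ennreal (N powr p * measure \<mu> (ccube x r) powr \<kappa>))"

lemma emeasure_power_measure_ccube_le:
  assumes "morrey_bound f N" "0 < r"
  shows "emeasure (power_measure (density_ratio f)) (ccube x r)
    \<le> ennreal (N powr p * measure \<mu> (ccube x r) powr \<kappa>)"
proof -
  have [measurable]: "f \<in> borel_measurable borel" using assms by (simp add: morrey_bound_def)
  have "(\<lambda>y. ennreal (\<bar>f y\<bar> powr p * u y powr (p / s))) \<in> borel_measurable lborel"
    by measurable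
  then show ?thesis
    using assms by (simp add: power_measure_density_ratio emeasure_density morrey_bound_def)
qed

lemma morrey_growth_density_ratio:
  assumes "morrey_bound f N"
  shows "morrey_growth (density_ratio f) (N powr p * A powr \<kappa>)"
proof -
  have [measurable]: "f \<in> borel_measurable borel" using assms by (simp add: morrey_bound_def)
  have "emeasure (power_measure (density_ratio f)) {y. \<psi> x y < t}
      \<le> ennreal (N powr p * A powr \<kappa> * t powr \<kappa>)"
    if "0 < t" for x t
    using emeasure_power_measure_ccube_le[OF assms] \<kappa>_range that A_pos
      emeasure_density_\<psi>_sublevel_right[of "\<lambda>y. ennreal (\<bar>f y\<bar> powr p * u y powr (p / s))"
        x "N powr p" \<kappa> t]
    by (simp add: power_measure_density_ratio powr_mult mult.assoc)
  then show ?thesis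
    by (simp add: morrey_growth_def density_ratio_def[abs_def] powr_real_measurable)
qed

lemma emeasure_power_measure_triple_le:
  assumes "morrey_bound f N" "0 < R"
  shows "emeasure (power_measure (density_ratio f)) (ccube z (3 * R))
    \<le> ennreal (N powr p * (A * (3 / 2) ^ DIM('a) * measure \<mu> (ccube z R)) powr \<kappa>)"
proof -
  have "emeasure (power_measure (density_ratio f)) (ccube z (3 * R))
      \<le> ennreal (N powr p * measure \<mu> (ccube z (3 * R)) powr \<kappa>)"
    using assms by (intro emeasure_power_measure_ccube_le) auto
  also have "\<dots> \<le> ennreal (N powr p * (A * (3 / 2) ^ DIM('a) * measure \<mu> (ccube z R)) powr \<kappa>)"
    using measure_\<mu>_ccube_le[of R "3 * R" z] assms \<kappa>_range
    by (intro ennreal_leI mult_left_mono powr_mono2) auto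
  finally show ?thesis .
qed

lemma morrey_scaling:
  assumes "0 < U" "0 < D"
  shows "(N powr p * A powr \<kappa>) powr (s / p) * (U / A) powr (\<kappa> * s / p - 1) * U
      = A * N powr s * U powr (\<kappa> * s / p)"
    and "(N powr p * A powr \<kappa>) powr (s / p - 1) * (U / A) powr (\<kappa> * (s / p - 1))
        * (N powr p * (D * U) powr \<kappa>)
      = D powr \<kappa> * N powr s * U powr (\<kappa> * s / p)"
proof -
  show "(N powr p * A powr \<kappa>) powr (s / p) * (U / A) powr (\<kappa> * s / p - 1) * U
      = A * N powr s * U powr (\<kappa> * s / p)"
    using assms A_pos p_gt_1 by (simp add: powr_mult powr_powr powr_divide powr_diff)
  have "(N powr p * A powr \<kappa>) powr (s / p - 1) * (U / A) powr (\<kappa> * (s / p - 1))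
        * (N powr p * (D * U) powr \<kappa>)
      = D powr \<kappa> * (N powr (p * (s / p - 1)) * N powr p) * (U powr (\<kappa> * (s / p - 1)) * U powr \<kappa>)"
    using assms A_pos by (simp add: powr_mult powr_powr powr_divide)
  also have "\<dots> = D powr \<kappa> * N powr s * U powr (\<kappa> * s / p)"
    unfolding powr_add[symmetric] using p_gt_1 by (simp add: right_diff_distrib)
  finally show "(N powr p * A powr \<kappa>) powr (s / p - 1) * (U / A) powr (\<kappa> * (s / p - 1))
      * (N powr p * (D * U) powr \<kappa>) = D powr \<kappa> * N powr s * U powr (\<kappa> * s / p)" .
qed

theorem riesz_potential_morrey:
  "\<exists>C>0. \<forall>f N z R. morrey_bound f N \<longrightarrow> 0 < R \<longrightarrow>
    (\<integral>\<^sup>+x\<in>ccube z R. riesz_potential \<gamma> f x epowr s \<partial>\<mu>)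
      \<le> ennreal (C * N powr s * measure \<mu> (ccube z R) powr (\<kappa> * s / p))"
proof -
  obtain C where C_pos: "0 < C" and bound: "\<And>h B T E E'. E \<in> sets \<mu> \<Longrightarrow> E' \<in> sets \<mu> \<Longrightarrow>
      morrey_growth h B \<Longrightarrow> 0 < T \<Longrightarrow> AE y in \<mu>. \<forall>x\<in>E. \<psi> x y < T \<longrightarrow> y \<in> E' \<Longrightarrow>
      (\<integral>\<^sup>+x\<in>E. potential h x epowr s \<partial>\<mu>)
        \<le> ennreal (C * B powr (s / p) * T powr (\<kappa> * s / p - 1)) * emeasure \<mu> E
          + ennreal (C * B powr (s / p - 1) * T powr (\<kappa> * (s / p - 1))) * emeasure (power_measure h) E'"
    using potential_bound by blast
  define D where "D = A * (3 / 2) ^ DIM('a)"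
  have D_pos: "0 < D" using A_pos by (simp add: D_def)
  define K where "K = C * (A + D powr \<kappa>)"
  have "(\<integral>\<^sup>+x\<in>ccube z R. riesz_potential \<gamma> f x epowr s \<partial>\<mu>)
      \<le> ennreal (K * N powr s * U powr (\<kappa> * s / p))"
    if f_bound: "morrey_bound f N" and R_pos: "0 < R"
      and U_def: "U = measure \<mu> (ccube z R)" for f N z R U
  proof -
    have U_pos: "0 < U" using measure_\<mu>_pos[OF R_pos] by (simp add: U_def)
    define B where "B = N powr p * A powr \<kappa>"
    define X where "X = B powr (s / p) * (U / A) powr (\<kappa> * s / p - 1)"
    define Y where "Y = B powr (s / p - 1) * (U / A) powr (\<kappa> * (s / p - 1))"
    have "(\<integral>\<^sup>+x\<in>ccube z R. riesz_potential \<gamma> f x epowr s \<partial>\<mu>)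
        \<le> ennreal (C * X) * ennreal U
          + ennreal (C * Y) * emeasure (power_measure (density_ratio f)) (ccube z (3 * R))"
      using bound[OF _ _ morrey_growth_density_ratio[OF f_bound] _ AE_mem_ccube_triple[OF R_pos, of z]]
        f_bound U_pos A_pos
      by (simp add: riesz_potential_eq_potential morrey_bound_def U_def emeasure_\<mu> B_def X_def Y_def
          mult.assoc)
    also have "\<dots> \<le> ennreal (C * X) * ennreal U + ennreal (C * Y) * ennreal (N powr p * (D * U) powr \<kappa>)"
      using emeasure_power_measure_triple_le[OF f_bound R_pos, of z]
      by (intro add_left_mono mult_left_mono) (simp_all add: D_def U_def)
    also have "\<dots> = ennreal (C * (X * U) + C * (Y * (N powr p * (D * U) powr \<kappa>)))"
      using C_pos U_pos
      by (simp add: X_def Y_def ennreal_mult[symmetric] ennreal_plus[symmetric] mult.assoc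
          del: ennreal_plus)
    also have "X * U = A * N powr s * U powr (\<kappa> * s / p)"
      unfolding X_def B_def using U_pos D_pos by (rule morrey_scaling)
    also have "Y * (N powr p * (D * U) powr \<kappa>) = D powr \<kappa> * N powr s * U powr (\<kappa> * s / p)"
      unfolding Y_def B_def using U_pos D_pos by (rule morrey_scaling)
    finally show ?thesis by (simp add: K_def algebra_simps)
  qed
  moreover have "0 < K" using C_pos A_pos by (simp add: K_def add_pos_nonneg)
  ultimately show ?thesis by blast
qed

lemma morrey_bound_if_morrey_space:
  assumes f_morrey: "morrey_space p \<kappa> w v f"
    and w_eq: "\<And>x. 0 \<le> w x" "AE x in lborel. w x = u x powr (p / s)"
    and measure_eq: "\<And>Q. cube Q \<Longrightarrow> measure \<mu> Q = wmeas v Q"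
    and f'_borel: "f' \<in> borel_measurable borel" "AE x in lborel. f x = f' x"
  shows "morrey_bound f' (morrey_norm p \<kappa> w v f)"
  unfolding morrey_bound_def
proof (intro conjI allI impI f'_borel(1) morrey_norm_nonneg f_morrey)
  fix x :: 'a and r :: real assume "0 < r"
  then have cube: "cube (ccube x r)" by (rule cube_ccube)
  have "(\<integral>\<^sup>+y\<in>ccube x r. ennreal (\<bar>f' y\<bar> powr p * u y powr (p / s)) \<partial>lborel)
      = (\<integral>\<^sup>+y\<in>ccube x r. ennreal (\<bar>f y\<bar> powr p * w y) \<partial>lborel)"
  proof (rule nn_integral_cong_AE, use f'_borel(2) w_eq(2) in eventually_elim)
    case (elim y)
    then show ?case by simp
  qed
  also have "\<dots> \<le> ennreal (morrey_norm p \<kappa> w v f powr p * wmeas v (ccube x r) powr \<kappa>)"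
    using measure_\<mu>_pos[OF \<open>0 < r\<close>, of x] p_gt_1 w_eq(1)
    by (intro morrey_space_nn_integral_le f_morrey cube) (simp_all add: measure_eq[OF cube])
  finally show "(\<integral>\<^sup>+y\<in>ccube x r. ennreal (\<bar>f' y\<bar> powr p * u y powr (p / s)) \<partial>lborel)
      \<le> ennreal (morrey_norm p \<kappa> w v f powr p * measure \<mu> (ccube x r) powr \<kappa>)"
    by (simp add: measure_eq[OF cube])
qed

lemma riesz_potential_morrey_space:
  assumes w_eq: "\<And>x. 0 \<le> w x" "AE x in lborel. w x = u x powr (p / s)"
    and measure_eq: "\<And>Q. cube Q \<Longrightarrow> measure \<mu> Q = wmeas v Q"
  shows "\<exists>C>0. \<forall>f Q. morrey_space p \<kappa> w v f \<longrightarrow> cube Q \<longrightarrow>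
    (\<integral>\<^sup>+x\<in>Q. riesz_potential \<gamma> f x epowr s \<partial>\<mu>)
      \<le> ennreal ((C * morrey_norm p \<kappa> w v f) powr s * wmeas v Q powr (\<kappa> * s / p))"
proof -
  obtain C where C_pos: "0 < C" and riesz_le: "\<And>f N z R. morrey_bound f N \<Longrightarrow> 0 < R \<Longrightarrow>
      (\<integral>\<^sup>+x\<in>ccube z R. riesz_potential \<gamma> f x epowr s \<partial>\<mu>)
        \<le> ennreal (C * N powr s * measure \<mu> (ccube z R) powr (\<kappa> * s / p))"
    using riesz_potential_morrey by blast
  have "(\<integral>\<^sup>+x\<in>Q. riesz_potential \<gamma> f x epowr s \<partial>\<mu>)
      \<le> ennreal ((C powr (1 / s) * morrey_norm p \<kappa> w v f) powr s * wmeas v Q powr (\<kappa> * s / p))"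
    if f_morrey: "morrey_space p \<kappa> w v f" and Q_cube: "cube Q" for f Q
  proof -
    obtain f' where f'_borel: "f' \<in> borel_measurable borel" "AE x in lborel. f x = f' x"
      using completion_ex_borel_measurable_real[of f lborel] f_morrey by (auto simp: morrey_space_def)
    obtain z R where "0 < R" "Q = ccube z R" using Q_cube by (rule cube_obtain_ccube)
    then have "(\<integral>\<^sup>+x\<in>Q. riesz_potential \<gamma> f x epowr s \<partial>\<mu>)
        \<le> ennreal (C * morrey_norm p \<kappa> w v f powr s * wmeas v Q powr (\<kappa> * s / p))"
      using riesz_le[OF morrey_bound_if_morrey_space[OF f_morrey w_eq measure_eq f'_borel], of R z]
        measure_eq[OF Q_cube]
      by (simp add: riesz_potential_cong_AE[OF f'_borel(2)])
    then show ?thesis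
      using C_pos s_pos morrey_norm_nonneg[OF f_morrey] by (simp add: powr_mult powr_powr del: s_eq)
  qed
  moreover have "0 < C powr (1 / s)" using C_pos by simp
  ultimately show ?thesis by blast
qed

end

theorem riesz_potential_weighted_morrey:
  fixes w :: "'a::euclidean_space \<Rightarrow> real"
  assumes w_weight: "weight w" and A1: "A1 (\<lambda>x. w x powr s)"
    and exponents: "0 < \<gamma>" "1 < p" "0 < s" "1 / s = 1 / p - \<gamma> / real DIM('a)" "0 < \<kappa>" "\<kappa> < p / s"
  shows "\<exists>C>0. \<forall>f Q. morrey_space p \<kappa> (\<lambda>x. w x powr p) (\<lambda>x. w x powr s) f \<longrightarrow> cube Q \<longrightarrow>
    (\<integral>\<^sup>+x\<in>Q. riesz_potential \<gamma> f x epowr s * ennreal (w x powr s) \<partial>lborel)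
      \<le> ennreal ((C * morrey_norm p \<kappa> (\<lambda>x. w x powr p) (\<lambda>x. w x powr s) f) powr s
          * wmeas (\<lambda>x. w x powr s) Q powr (\<kappa> * s / p))"
proof -
  define v where "v = (\<lambda>x. w x powr s)"
  have v_weight: "weight v" using A1 by (simp add: A1_def v_def)
  obtain u A where u_A1: "pointwise_A1 u A" "AE x in lborel. v x = u x"
    and u_wmeas: "\<And>Q. cube Q \<Longrightarrow> emeasure (density lborel (\<lambda>x. ennreal (u x))) Q = ennreal (wmeas v Q)"
    using A1_borel_representative A1 unfolding v_def by blast
  interpret pointwise_A1_morrey u A p s \<kappa> \<gamma>
    using u_A1(1) exponents by (simp add: pointwise_A1_morrey_def pointwise_A1_morrey_axioms_def)
  have measure_eq: "measure \<mu> Q = wmeas v Q" if "cube Q" for Q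
    using u_wmeas[OF that] wmeas_pos[OF v_weight that] by (simp add: \<mu>_def measure_def)
  have "AE x in lborel. 0 < w x"
    using w_weight by (simp add: weight_def AE_completion_iff)
  then have w_powr: "AE x in lborel. w x powr p = u x powr (p / s)"
    using u_A1(2)
  proof eventually_elim
    case (elim x)
    then have "u x powr (p / s) = (w x powr s) powr (p / s)" by (simp add: v_def)
    then show ?case using \<open>0 < s\<close> elim(1) by (simp add: powr_powr)
  qed
  have "(\<integral>\<^sup>+x\<in>Q. riesz_potential \<gamma> f x epowr s * ennreal (v x) \<partial>lborel)
      = (\<integral>\<^sup>+x\<in>Q. riesz_potential \<gamma> f x epowr s \<partial>\<mu>)"
    if f_morrey: "morrey_space p \<kappa> (\<lambda>x. w x powr p) v f" and Q_cube: "cube Q" for f Q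
  proof -
    have "(\<integral>\<^sup>+x\<in>Q. riesz_potential \<gamma> f x epowr s * ennreal (v x) \<partial>lborel)
        = (\<integral>\<^sup>+x. ennreal (u x) * (riesz_potential \<gamma> f x epowr s * indicator Q x) \<partial>lborel)"
      using u_A1(2) by (intro nn_integral_cong_AE) (auto elim!: eventually_mono simp: mult_ac)
    moreover have "riesz_potential \<gamma> f \<in> borel_measurable lborel"
      using f_morrey by (intro riesz_potential_measurable) (simp add: morrey_space_def)
    moreover have "Q \<in> sets borel" using Q_cube by (auto simp: cube_def)
    ultimately show ?thesis
      unfolding \<mu>_def by (simp add: nn_integral_density)
  qed
  then show ?thesis
    using riesz_potential_morrey_space[of "\<lambda>x. w x powr p" v] w_powr measure_eq by (simp add: v_def)
qed

section \<open>Campanato's characterisation of Hoelder continuity\<close>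

abbreviation corner_cube :: "'a::euclidean_space \<Rightarrow> real \<Rightarrow> 'a set" where
  "corner_cube x h \<equiv> cbox x (x + h *\<^sub>R One)"

lemma cube_corner_cube: "0 < h \<Longrightarrow> cube (corner_cube x h)"
  by (auto simp: cube_def)

lemma measure_corner_cube:
  fixes x :: "'a::euclidean_space"
  assumes "0 \<le> h"
  shows "measure lebesgue (corner_cube x h) = h ^ DIM('a)"
  using content_cbox_plus[of x h] assms by simp

lemma set_integral_const_cube:
  assumes "cube Q"
  shows "set_integrable lebesgue Q (\<lambda>_. c :: real)" "(LINT x:Q|lebesgue. c) = measure lebesgue Q * c"
proof -
  obtain x h where "Q = corner_cube x h" using assms by (auto simp: cube_def)
  then have "integrable lebesgue (indicator Q :: _ \<Rightarrow> real)"
    using emeasure_lborel_cbox_finite by (intro integrable_real_indicator) auto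
  then show "set_integrable lebesgue Q (\<lambda>_. c)" "(LINT x:Q|lebesgue. c) = measure lebesgue Q * c"
    by (simp_all add: set_integrable_def set_lebesgue_integral_def)
qed

lemma abs_avg_minus_le:
  assumes b_loc_int: "loc_int b" and cubes: "cube Q" "cube Q'" "Q' \<subseteq> Q"
  shows "\<bar>avg b Q' - c\<bar> \<le> (LINT x:Q|lebesgue. \<bar>b x - c\<bar>) / measure lebesgue Q'"
proof -
  have Q'_pos: "0 < measure lebesgue Q'"
    using cubes(2) by (auto simp: cube_def measure_corner_cube simp del: measure_completion)
  have integrable: "set_integrable lebesgue Q (\<lambda>x. b x - c)" if "cube Q" for Q
    using b_loc_int that by (intro set_integral_diff set_integral_const_cube) (auto simp: loc_int_def)
  have "(LINT x:Q'|lebesgue. b x - c) = wmeas b Q' - measure lebesgue Q' * c"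
    using b_loc_int cubes
    by (subst set_integral_diff) (auto simp: loc_int_def wmeas_def set_integral_const_cube)
  then have "avg b Q' - c = (LINT x:Q'|lebesgue. b x - c) / measure lebesgue Q'"
    using Q'_pos by (simp add: avg_def diff_divide_distrib)
  then have "\<bar>avg b Q' - c\<bar> = \<bar>LINT x:Q'|lebesgue. b x - c\<bar> / measure lebesgue Q'"
    by simp
  also have "\<bar>LINT x:Q'|lebesgue. b x - c\<bar> \<le> (LINT x:Q'|lebesgue. \<bar>b x - c\<bar>)"
    unfolding set_lebesgue_integral_def
    by (rule order_trans[OF integral_abs_bound]) (simp add: abs_mult)
  also have "\<dots> \<le> (LINT x:Q|lebesgue. \<bar>b x - c\<bar>)"
    unfolding set_lebesgue_integral_def
    using integrable[OF cubes(1), THEN set_integrable_abs]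
      integrable[OF cubes(2), THEN set_integrable_abs] cubes(3)
    by (intro integral_mono) (auto simp: set_integrable_def indicator_def)
  finally show ?thesis using Q'_pos by (simp add: divide_right_mono)
qed

lemma lip_osc_le_lip_norm: "lip_space \<beta> b \<Longrightarrow> cube Q \<Longrightarrow> lip_osc \<beta> b Q \<le> lip_norm \<beta> b"
  unfolding lip_norm_def by (intro cSUP_upper) (auto simp: lip_space_def)

lemma lip_norm_nonneg:
  fixes b :: "'a::euclidean_space \<Rightarrow> real"
  assumes "lip_space \<beta> b"
  shows "0 \<le> lip_norm \<beta> b"
proof -
  have "0 \<le> lip_osc \<beta> b (corner_cube 0 1)"
    by (simp add: lip_osc_def set_lebesgue_integral_def)
  then show ?thesis
    using lip_osc_le_lip_norm[OF assms cube_corner_cube[of 1 0]] by simp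
qed

lemma avg_corner_cube_diff_le:
  fixes b :: "'a::euclidean_space \<Rightarrow> real"
  assumes b_lip: "lip_space \<beta> b" and sides_pos: "0 < h" "0 < r"
    and subset: "corner_cube y r \<subseteq> corner_cube x h"
  shows "\<bar>avg b (corner_cube y r) - avg b (corner_cube x h)\<bar>
    \<le> (h / r) ^ DIM('a) * lip_norm \<beta> b * h powr \<beta>"
proof -
  define I where "I = (LINT z:corner_cube x h|lebesgue. \<bar>b z - avg b (corner_cube x h)\<bar>)"
  have "measure lebesgue (corner_cube x h) powr (\<beta> / real DIM('a)) = h powr \<beta>"
    using sides_pos
    by (simp add: measure_corner_cube powr_realpow[symmetric] powr_powr del: measure_completion)
  then have "1 / h powr \<beta> * (1 / h ^ DIM('a)) * I \<le> lip_norm \<beta> b"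
    using lip_osc_le_lip_norm[OF b_lip cube_corner_cube[OF sides_pos(1), of x]] sides_pos
    by (simp add: lip_osc_def I_def measure_corner_cube del: measure_completion)
  then have I_le: "I \<le> lip_norm \<beta> b * h powr \<beta> * h ^ DIM('a)"
    using sides_pos by (simp add: field_simps)
  have "\<bar>avg b (corner_cube y r) - avg b (corner_cube x h)\<bar> \<le> I / r ^ DIM('a)"
    using abs_avg_minus_le[OF _ cube_corner_cube[OF sides_pos(1)]
        cube_corner_cube[OF sides_pos(2)] subset] b_lip sides_pos
    by (simp add: lip_space_def I_def measure_corner_cube del: measure_completion)
  also have "\<dots> \<le> lip_norm \<beta> b * h powr \<beta> * h ^ DIM('a) / r ^ DIM('a)"
    using I_le sides_pos by (simp add: divide_right_mono)
  finally show ?thesis by (simp add: power_divide mult_ac)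
qed

definition oscillation_const :: "nat \<Rightarrow> real \<Rightarrow> real" where
  "oscillation_const n \<beta> = 2 ^ n / (1 - 2 powr - \<beta>)"

lemma oscillation_const_pos: "0 < \<beta> \<Longrightarrow> 0 < oscillation_const n \<beta>"
  by (simp add: oscillation_const_def powr_less_one)

lemma oscillation_const_telescope:
  assumes "0 < \<beta>"
  shows "oscillation_const n \<beta> * 2 powr - \<beta> + 2 ^ n = oscillation_const n \<beta>"
proof -
  have "2 powr - \<beta> < (1::real)" using assms by (simp add: powr_less_one)
  then have "oscillation_const n \<beta> * (1 - 2 powr - \<beta>) = 2 ^ n"
    unfolding oscillation_const_def by (subst nonzero_eq_divide_eq[symmetric]) auto
  then show ?thesis by (simp add: right_diff_distrib)
qed

lemma avg_dyadic_corner_cube_diff_le: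
  fixes b :: "'a::euclidean_space \<Rightarrow> real"
  assumes b_lip: "lip_space \<beta> b" and \<beta>_pos: "0 < \<beta>" and "0 < h"
  shows "\<bar>avg b (corner_cube x (h / 2 ^ j)) - avg b (corner_cube x h)\<bar>
    \<le> oscillation_const DIM('a) \<beta> * lip_norm \<beta> b * h powr \<beta>"
  using \<open>0 < h\<close>
proof (induction j arbitrary: h)
  case 0
  then show ?case
    using oscillation_const_pos[OF \<beta>_pos, of "DIM('a)"] lip_norm_nonneg[OF b_lip] by simp
next
  case (Suc j)
  define D where "D = oscillation_const DIM('a) \<beta>"
  have "\<bar>avg b (corner_cube x (h / 2)) - avg b (corner_cube x h)\<bar>
      \<le> 2 ^ DIM('a) * lip_norm \<beta> b * h powr \<beta>"
    using avg_corner_cube_diff_le[OF b_lip, of h "h / 2" x x] Suc.prems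
    by (simp add: subset_box inner_add_left)
  moreover have "\<bar>avg b (corner_cube x (h / 2 / 2 ^ j)) - avg b (corner_cube x (h / 2))\<bar>
      \<le> D * lip_norm \<beta> b * (h / 2) powr \<beta>"
    unfolding D_def using Suc.prems by (intro Suc.IH) simp
  moreover have "D * lip_norm \<beta> b * (h / 2) powr \<beta> + 2 ^ DIM('a) * lip_norm \<beta> b * h powr \<beta>
      = D * lip_norm \<beta> b * h powr \<beta>"
  proof -
    have "(h / 2) powr \<beta> = 2 powr - \<beta> * h powr \<beta>"
      using Suc.prems by (simp add: powr_divide powr_minus_divide)
    then have "D * lip_norm \<beta> b * (h / 2) powr \<beta> + 2 ^ DIM('a) * lip_norm \<beta> b * h powr \<beta>
        = (D * 2 powr - \<beta> + 2 ^ DIM('a)) * (lip_norm \<beta> b * h powr \<beta>)"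
      by (simp add: distrib_right distrib_left mult_ac)
    then show ?thesis
      unfolding D_def oscillation_const_telescope[OF \<beta>_pos] by (simp add: mult.assoc)
  qed
  ultimately show ?case
    unfolding D_def[symmetric] power_Suc divide_divide_eq_left[symmetric] by linarith
qed

lemma loc_int_integrable_on_cbox:
  assumes "loc_int f"
  shows "f integrable_on cbox a b"
proof -
  obtain r where r_bound: "0 < r" "\<And>x. x \<in> cbox a b \<Longrightarrow> norm x \<le> r"
    using bounded_cbox[of a b] unfolding bounded_pos by blast
  have "cbox a b \<subseteq> ccube 0 r"
  proof
    fix y assume "y \<in> cbox a b"
    then show "y \<in> ccube 0 r"
      using order_trans[OF infnorm_le_norm r_bound(2), of y] by (simp add: mem_ccube infnorm_neg)
  qed
  moreover have "f integrable_on ccube 0 r"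
    using assms cube_ccube[OF r_bound(1)]
    by (intro set_lebesgue_integral_eq_integral) (auto simp: loc_int_def)
  ultimately show ?thesis
    unfolding ccube_def by (rule integrable_on_subcbox[rotated])
qed

lemma avg_corner_cube_eq_integral:
  fixes f :: "'a::euclidean_space \<Rightarrow> real"
  assumes "loc_int f" "0 < h"
  shows "avg f (corner_cube x h) = integral (corner_cube x h) f /\<^sub>R h ^ DIM('a)"
proof -
  have "set_integrable lebesgue (corner_cube x h) f"
    using assms cube_corner_cube by (auto simp: loc_int_def)
  then show ?thesis
    using assms unfolding avg_def wmeas_def
    by (simp add: set_lebesgue_integral_eq_integral(2) measure_corner_cube divide_inverse mult.commute
        del: measure_completion)
qed

lemma avg_corner_cube_tendsto:
  fixes f :: "'a::euclidean_space \<Rightarrow> real"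
  assumes f_loc_int: "loc_int f"
  obtains N where "negligible N" "\<And>x. x \<notin> N \<Longrightarrow> ((\<lambda>h. avg f (corner_cube x h)) \<longlongrightarrow> f x) (at_right 0)"
proof -
  obtain N where N_negligible: "negligible N" and deriv: "\<And>x e. x \<notin> N \<Longrightarrow> 0 < e \<Longrightarrow>
      \<exists>d>0. \<forall>h. 0 < h \<and> h < d \<longrightarrow> norm (integral (corner_cube x h) f /\<^sub>R h ^ DIM('a) - f x) < e"
    using integrable_ccontinuous_explicit[of f] loc_int_integrable_on_cbox[OF f_loc_int] by metis
  have "((\<lambda>h. avg f (corner_cube x h)) \<longlongrightarrow> f x) (at_right 0)" if x_notin: "x \<notin> N" for x
  proof (rule tendstoI)
    fix e :: real assume "0 < e"
    then obtain d where "0 < d"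
      "\<And>h. 0 < h \<Longrightarrow> h < d \<Longrightarrow> norm (integral (corner_cube x h) f /\<^sub>R h ^ DIM('a) - f x) < e"
      using deriv[OF x_notin] by blast
    then show "\<forall>\<^sub>F h in at_right 0. dist (avg f (corner_cube x h)) (f x) < e"
      unfolding eventually_at_right_field
      by (intro exI[of _ d]) (auto simp: avg_corner_cube_eq_integral[OF f_loc_int] dist_norm)
  qed
  then show ?thesis using N_negligible that by blast
qed

lemma abs_minus_avg_corner_cube_le:
  fixes b :: "'a::euclidean_space \<Rightarrow> real"
  assumes b_lip: "lip_space \<beta> b" "0 < \<beta>" and h_pos: "0 < h"
    and avg_tendsto: "((\<lambda>h. avg b (corner_cube x h)) \<longlongrightarrow> b x) (at_right 0)"
  shows "\<bar>b x - avg b (corner_cube x h)\<bar> \<le> oscillation_const DIM('a) \<beta> * lip_norm \<beta> b * h powr \<beta>"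
proof (rule tendsto_upperbound)
  have "(\<lambda>j::nat. h / 2 ^ j) \<longlonglongrightarrow> 0" using LIMSEQ_divide_realpow_zero[of 2 h] by simp
  then have "filterlim (\<lambda>j::nat. h / 2 ^ j) (at_right 0) sequentially"
    using h_pos by (intro tendsto_imp_filterlim_at_right) simp_all
  then have "(\<lambda>j. avg b (corner_cube x (h / 2 ^ j))) \<longlonglongrightarrow> b x"
    by (rule filterlim_compose[OF avg_tendsto])
  then show "(\<lambda>j. \<bar>avg b (corner_cube x (h / 2 ^ j)) - avg b (corner_cube x h)\<bar>)
      \<longlonglongrightarrow> \<bar>b x - avg b (corner_cube x h)\<bar>"
    by (intro tendsto_intros)
qed (use avg_dyadic_corner_cube_diff_le[OF b_lip h_pos] in simp_all)

lemma avg_translated_corner_cube_diff_le: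
  fixes b :: "'a::euclidean_space \<Rightarrow> real"
  assumes b_lip: "lip_space \<beta> b" and r_range: "0 < r" "infnorm (x - y) \<le> r"
  shows "\<bar>avg b (corner_cube x r) - avg b (corner_cube y r)\<bar>
    \<le> 2 * 3 ^ DIM('a) * 3 powr \<beta> * lip_norm \<beta> b * r powr \<beta>"
proof -
  define Q where "Q = corner_cube (x - r *\<^sub>R One) (3 * r)"
  have avg_near_le: "\<bar>avg b (corner_cube z r) - avg b Q\<bar>
      \<le> 3 ^ DIM('a) * 3 powr \<beta> * lip_norm \<beta> b * r powr \<beta>"
    if "infnorm (x - z) \<le> r" for z
  proof -
    have "(x - r *\<^sub>R One) \<bullet> i \<le> z \<bullet> i \<and> (z + r *\<^sub>R One) \<bullet> i \<le> (x - r *\<^sub>R One + (3 * r) *\<^sub>R One) \<bullet> i"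
      if "i \<in> Basis" for i
      using Basis_le_infnorm[OF that, of "x - z"] \<open>infnorm (x - z) \<le> r\<close> that
      by (simp add: inner_diff_left inner_add_left abs_le_iff)
    then have "corner_cube z r \<subseteq> Q"
      by (simp add: Q_def subset_box)
    then show ?thesis
      using avg_corner_cube_diff_le[OF b_lip, of "3 * r" r z "x - r *\<^sub>R One"] r_range
      by (simp add: Q_def powr_mult mult_ac)
  qed
  show ?thesis using avg_near_le[of x] avg_near_le[of y] r_range by (simp add: infnorm_0)
qed

definition campanato_const :: "nat \<Rightarrow> real \<Rightarrow> real" where
  "campanato_const n \<beta> = 2 * (oscillation_const n \<beta> + 3 ^ n * 3 powr \<beta>)"

lemma campanato_const_pos: "0 < \<beta> \<Longrightarrow> 0 < campanato_const n \<beta>"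
  by (simp add: campanato_const_def oscillation_const_pos add_pos_pos)

theorem lip_space_Holder:
  fixes b :: "'a::euclidean_space \<Rightarrow> real"
  assumes b_lip: "lip_space \<beta> b" and \<beta>_pos: "0 < \<beta>"
  obtains N where "negligible N" "\<And>x y. x \<notin> N \<Longrightarrow> y \<notin> N \<Longrightarrow>
    \<bar>b x - b y\<bar> \<le> campanato_const DIM('a) \<beta> * lip_norm \<beta> b * infnorm (x - y) powr \<beta>"
proof -
  obtain N where N_negligible: "negligible N"
    and avg_tendsto: "\<And>x. x \<notin> N \<Longrightarrow> ((\<lambda>h. avg b (corner_cube x h)) \<longlongrightarrow> b x) (at_right 0)"
    using avg_corner_cube_tendsto b_lip unfolding lip_space_def by metis
  have "\<bar>b x - b y\<bar> \<le> campanato_const DIM('a) \<beta> * lip_norm \<beta> b * infnorm (x - y) powr \<beta>"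
    if "x \<notin> N" "y \<notin> N" for x y
  proof (cases "x = y")
    case False
    define r where "r = infnorm (x - y)"
    define D where "D = oscillation_const DIM('a) \<beta> * lip_norm \<beta> b * r powr \<beta>"
    have r_pos: "0 < r" using False by (simp add: r_def infnorm_pos_lt)
    have "\<bar>b x - avg b (corner_cube x r)\<bar> \<le> D" "\<bar>b y - avg b (corner_cube y r)\<bar> \<le> D"
      using abs_minus_avg_corner_cube_le[OF b_lip \<beta>_pos r_pos avg_tendsto] that by (simp_all add: D_def)
    moreover have "\<bar>avg b (corner_cube x r) - avg b (corner_cube y r)\<bar>
        \<le> 2 * 3 ^ DIM('a) * 3 powr \<beta> * lip_norm \<beta> b * r powr \<beta>"
      using r_pos by (intro avg_translated_corner_cube_diff_le b_lip) (simp_all add: r_def)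
    ultimately have "\<bar>b x - b y\<bar> \<le> 2 * D + 2 * 3 ^ DIM('a) * 3 powr \<beta> * lip_norm \<beta> b * r powr \<beta>"
      by linarith
    then show ?thesis by (simp add: campanato_const_def D_def r_def algebra_simps)
  qed (simp add: infnorm_0)
  then show ?thesis using N_negligible that by blast
qed

section \<open>The commutator\<close>

text \<open>If \<open>g\<close> is not integrable and \<open>c \<noteq> 0\<close>, then finiteness of the right-hand side forces \<open>b g\<close> not to
  be integrable either, and both integrals on the left are \<open>0\<close>.\<close>
lemma integral_commutator_bound:
  fixes g b :: "'b \<Rightarrow> real"
  assumes [measurable]: "g \<in> borel_measurable M" "b \<in> borel_measurable M"
  shows "ennreal \<bar>c * (LINT y|M. g y) - (LINT y|M. b y * g y)\<bar> \<le> (\<integral>\<^sup>+y. ennreal \<bar>(c - b y) * g y\<bar> \<partial>M)"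
proof (cases "(\<integral>\<^sup>+y. ennreal \<bar>(c - b y) * g y\<bar> \<partial>M) = \<infinity>")
  case False
  then have diff_integrable: "integrable M (\<lambda>y. (c - b y) * g y)"
    by (intro integrableI_bounded) (auto simp: less_top)
  have bg_eq: "(\<lambda>y. b y * g y) = (\<lambda>y. c * g y - (c - b y) * g y)"
    by (simp add: algebra_simps)
  have "c * (LINT y|M. g y) - (LINT y|M. b y * g y) = (LINT y|M. (c - b y) * g y)
      \<or> c * (LINT y|M. g y) - (LINT y|M. b y * g y) = 0"
  proof (cases "c = 0 \<or> integrable M g")
    case True
    then have "integrable M (\<lambda>y. c * g y)" by auto
    then have "(LINT y|M. b y * g y) = (LINT y|M. c * g y) - (LINT y|M. (c - b y) * g y)"
      unfolding bg_eq using diff_integrable by (rule Bochner_Integration.integral_diff)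
    then show ?thesis by simp
  next
    case False
    have "\<not> integrable M (\<lambda>y. b y * g y)"
    proof
      assume "integrable M (\<lambda>y. b y * g y)"
      then have "integrable M (\<lambda>y. b y * g y + (c - b y) * g y)"
        using diff_integrable by (rule Bochner_Integration.integrable_add)
      then show False using False by (simp add: algebra_simps)
    qed
    then show ?thesis using False by (simp add: not_integrable_integral_eq)
  qed
  then show ?thesis
    using integral_norm_bound_ennreal[OF diff_integrable] by auto
qed simp

lemma riesz_kernel_measurable:
  "(\<lambda>y. norm (x - y) powr a) \<in> borel_measurable (lebesgue :: 'a::euclidean_space measure)"
  by (rule measurable_completion) measurable

lemma frac_int_measurable:
  fixes f :: "'a::euclidean_space \<Rightarrow> real"
  assumes f_measurable: "f \<in> borel_measurable lebesgue"
  shows "frac_int c \<alpha> f \<in> borel_measurable lebesgue"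
proof -
  obtain f' where [measurable]: "f' \<in> borel_measurable borel" and f_eq_f': "AE y in lborel. f y = f' y"
    using completion_ex_borel_measurable_real[of f lborel] f_measurable by auto
  have f'_measurable: "f' \<in> borel_measurable lebesgue" by (rule measurable_completion) measurable
  have "frac_int c \<alpha> f x = c * (LINT y|lborel. f' y / norm (x - y) powr (real DIM('a) - \<alpha>))" for x
  proof -
    have "(LINT y|lebesgue. f y / norm (x - y) powr (real DIM('a) - \<alpha>))
        = (LINT y|lebesgue. f' y / norm (x - y) powr (real DIM('a) - \<alpha>))"
      using AE_completion[OF f_eq_f'] f_measurable f'_measurable
      by (intro integral_cong_AE borel_measurable_divide riesz_kernel_measurable)
        (auto elim: eventually_mono)
    also have "\<dots> = (LINT y|lborel. f' y / norm (x - y) powr (real DIM('a) - \<alpha>))"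
      by (rule integral_completion) measurable
    finally show ?thesis by (simp add: frac_int_def)
  qed
  then have "frac_int c \<alpha> f = (\<lambda>x. c * (LINT y|lborel. f' y / norm (x - y) powr (real DIM('a) - \<alpha>)))"
    by blast
  then show ?thesis
    by (simp only:) (rule measurable_completion; measurable)
qed

lemma commutator_measurable:
  fixes f :: "'a::euclidean_space \<Rightarrow> real"
  assumes "f \<in> borel_measurable lebesgue" "b \<in> borel_measurable lebesgue"
  shows "commutator b c \<alpha> f \<in> borel_measurable lebesgue"
  unfolding commutator_def[abs_def]
  using assms by (intro borel_measurable_diff borel_measurable_times frac_int_measurable)

lemma Holder_difference_times_kernel_le:
  fixes x y :: "'a::euclidean_space"
  assumes "x \<noteq> y" "\<bar>d\<bar> \<le> K * infnorm (x - y) powr \<beta>" "0 \<le> K" "\<alpha> \<le> real DIM('a)"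
  shows "\<bar>d * (t / norm (x - y) powr (real DIM('a) - \<alpha>))\<bar>
    \<le> K * (\<bar>t\<bar> * infnorm (x - y) powr (\<alpha> + \<beta> - real DIM('a)))"
proof -
  define r where "r = infnorm (x - y)"
  have r_le: "0 < r" "r \<le> norm (x - y)"
    using assms by (simp_all add: r_def infnorm_pos_lt infnorm_le_norm)
  have "\<bar>d * (t / norm (x - y) powr (real DIM('a) - \<alpha>))\<bar>
      = \<bar>d\<bar> * (\<bar>t\<bar> * norm (x - y) powr (\<alpha> - real DIM('a)))"
    using powr_minus[of "norm (x - y)" "real DIM('a) - \<alpha>"] by (simp add: abs_mult divide_inverse)
  also have "\<dots> \<le> (K * r powr \<beta>) * (\<bar>t\<bar> * r powr (\<alpha> - real DIM('a)))"
    using assms r_le unfolding r_def[symmetric] by (intro mult_mono mult_left_mono powr_mono2') auto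
  also have "\<dots> = K * (\<bar>t\<bar> * (r powr \<beta> * r powr (\<alpha> - real DIM('a))))"
    by (simp only: mult_ac)
  also have "r powr \<beta> * r powr (\<alpha> - real DIM('a)) = r powr (\<alpha> + \<beta> - real DIM('a))"
    unfolding powr_add[symmetric] by (simp add: add.commute add_diff_eq)
  finally show ?thesis by (simp add: r_def)
qed

lemma commutator_le_riesz_potential:
  fixes b f :: "'a::euclidean_space \<Rightarrow> real"
  assumes b_measurable: "b \<in> borel_measurable lebesgue"
    and f_measurable: "f \<in> borel_measurable lebesgue"
    and Holder: "AE y in lebesgue. \<bar>b x - b y\<bar> \<le> K * infnorm (x - y) powr \<beta>"
    and "0 \<le> K" "0 \<le> c" "\<alpha> \<le> real DIM('a)"
  shows "ennreal \<bar>commutator b c \<alpha> f x\<bar> \<le> ennreal (c * K) * riesz_potential (\<alpha> + \<beta>) f x"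
proof -
  define g where "g y = f y / norm (x - y) powr (real DIM('a) - \<alpha>)" for y
  define k where "k y = \<bar>f y\<bar> * infnorm (x - y) powr (\<alpha> + \<beta> - real DIM('a))" for y
  have g_measurable: "g \<in> borel_measurable lebesgue"
    unfolding g_def by (intro borel_measurable_divide riesz_kernel_measurable f_measurable)
  have "(\<lambda>y. infnorm (x - y) powr (\<alpha> + \<beta> - real DIM('a))) \<in> borel_measurable lebesgue"
    by (rule measurable_completion) measurable
  then have k_measurable: "k \<in> borel_measurable lebesgue"
    unfolding k_def by (intro borel_measurable_times borel_measurable_abs f_measurable)
  have pointwise: "AE y in lebesgue. \<bar>(b x - b y) * g y\<bar> \<le> K * k y"
    using Holder AE_completion[OF AE_lborel_singleton[of x]]
  proof eventually_elim
    case (elim y)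
    then show ?case
      unfolding g_def k_def using assms by (intro Holder_difference_times_kernel_le) auto
  qed
  have "commutator b c \<alpha> f x = c * (b x * (LINT y|lebesgue. g y) - (LINT y|lebesgue. b y * g y))"
    by (simp add: commutator_def frac_int_def g_def right_diff_distrib mult_ac)
  then have "ennreal \<bar>commutator b c \<alpha> f x\<bar>
      = ennreal c * ennreal \<bar>b x * (LINT y|lebesgue. g y) - (LINT y|lebesgue. b y * g y)\<bar>"
    using \<open>0 \<le> c\<close> by (simp add: abs_mult ennreal_mult)
  also have "\<dots> \<le> ennreal c * (\<integral>\<^sup>+y. ennreal \<bar>(b x - b y) * g y\<bar> \<partial>lebesgue)"
    by (intro mult_left_mono integral_commutator_bound g_measurable b_measurable) simp
  also have "\<dots> \<le> ennreal c * (\<integral>\<^sup>+y. ennreal K * ennreal (k y) \<partial>lebesgue)"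
    using pointwise \<open>0 \<le> K\<close>
    by (intro mult_left_mono nn_integral_mono_AE)
      (auto elim!: eventually_mono simp: ennreal_mult'[symmetric] intro!: ennreal_leI)
  also have "\<dots> = ennreal (c * K) * (\<integral>\<^sup>+y. ennreal (k y) \<partial>lebesgue)"
    using assms k_measurable by (simp add: nn_integral_cmult ennreal_mult mult.assoc)
  finally show ?thesis
    by (simp add: riesz_potential_def k_def nn_integral_completion)
qed

lemma commutator_le_lip_norm_riesz_potential:
  fixes b f :: "'a::euclidean_space \<Rightarrow> real"
  assumes b_lip: "lip_space \<beta> b" and \<beta>_pos: "0 < \<beta>" and f_measurable: "f \<in> borel_measurable lebesgue"
    and c_nonneg: "0 \<le> c" and \<alpha>_le: "\<alpha> \<le> real DIM('a)"
  shows "AE x in lebesgue. ennreal \<bar>commutator b c \<alpha> f x\<bar>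
    \<le> ennreal (c * (campanato_const DIM('a) \<beta> * lip_norm \<beta> b)) * riesz_potential (\<alpha> + \<beta>) f x"
proof -
  obtain N where "negligible N" and Holder: "\<And>x y. x \<notin> N \<Longrightarrow> y \<notin> N \<Longrightarrow>
      \<bar>b x - b y\<bar> \<le> campanato_const DIM('a) \<beta> * lip_norm \<beta> b * infnorm (x - y) powr \<beta>"
    using lip_space_Holder[OF b_lip \<beta>_pos] by blast
  then have AE_notin_N: "AE x in lebesgue. x \<notin> N"
    by (simp add: negligible_iff_null_sets AE_not_in)
  then show ?thesis
  proof eventually_elim
    case (elim x)
    have "AE y in lebesgue. \<bar>b x - b y\<bar>
        \<le> campanato_const DIM('a) \<beta> * lip_norm \<beta> b * infnorm (x - y) powr \<beta>"
      using AE_notin_N by eventually_elim (rule Holder[OF elim])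
    then show ?case
      using b_lip f_measurable c_nonneg \<alpha>_le campanato_const_pos[OF \<beta>_pos, of "DIM('a)"]
        lip_norm_nonneg[OF b_lip]
      by (intro commutator_le_riesz_potential) (auto simp: lip_space_def loc_int_def)
  qed
qed

lemma
  fixes b f u v :: "'a::euclidean_space \<Rightarrow> real"
  assumes b_lip: "lip_space \<beta> b" and \<beta>_pos: "0 < \<beta>" and f_measurable: "f \<in> borel_measurable lebesgue"
    and "0 \<le> c" "\<alpha> \<le> real DIM('a)"
    and u_measurable: "u \<in> borel_measurable lebesgue" and u_nonneg: "\<And>x. 0 \<le> u x"
    and s_pos: "0 < s" and N_nonneg: "0 \<le> N" and v_pos: "\<And>Q. cube Q \<Longrightarrow> 0 < wmeas v Q"
    and riesz_le: "\<And>Q. cube Q \<Longrightarrow>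
      (\<integral>\<^sup>+x\<in>Q. riesz_potential (\<alpha> + \<beta>) f x epowr s * ennreal (u x) \<partial>lborel)
        \<le> ennreal (N powr s * wmeas v Q powr \<kappa>)"
  shows morrey_space_commutator: "morrey_space s \<kappa> u v (commutator b c \<alpha> f)"
    and morrey_norm_commutator_le: "morrey_norm s \<kappa> u v (commutator b c \<alpha> f)
      \<le> c * (campanato_const DIM('a) \<beta> * lip_norm \<beta> b) * N"
proof -
  have b_measurable: "b \<in> borel_measurable lebesgue"
    using b_lip by (simp add: lip_space_def loc_int_def)
  have const_nonneg: "0 \<le> c * (campanato_const DIM('a) \<beta> * lip_norm \<beta> b)"
    using \<open>0 \<le> c\<close> campanato_const_pos[OF \<beta>_pos, of "DIM('a)"] lip_norm_nonneg[OF b_lip] by simp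
  have dominated: "AE x in lebesgue. ennreal \<bar>commutator b c \<alpha> f x\<bar>
      \<le> ennreal (c * (campanato_const DIM('a) \<beta> * lip_norm \<beta> b)) * riesz_potential (\<alpha> + \<beta>) f x"
    using assms by (intro commutator_le_lip_norm_riesz_potential)
  note bounds = morrey_space_dominated[OF commutator_measurable[OF f_measurable b_measurable]
      u_measurable u_nonneg s_pos const_nonneg N_nonneg v_pos dominated riesz_le
      riesz_potential_measurable[OF f_measurable]]
  show "morrey_space s \<kappa> u v (commutator b c \<alpha> f)"
    by (rule bounds)
  show "morrey_norm s \<kappa> u v (commutator b c \<alpha> f)
      \<le> c * (campanato_const DIM('a) \<beta> * lip_norm \<beta> b) * N"
    by (rule bounds)
qed

theorem theorem2:
  fixes w b :: "'a::euclidean_space \<Rightarrow> real"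
    and \<alpha> \<beta> p s \<kappa> c :: real
  defines "n \<equiv> real DIM('a)"
  assumes "0 < \<beta>" "\<beta> < 1"
    and "0 < \<alpha>" "\<alpha> < n" "\<alpha> + \<beta> < n"
    and "1 < p" "p < n / (\<alpha> + \<beta>)"
    and "1 / s = 1 / p - (\<alpha> + \<beta>) / n"
    and "0 < \<kappa>" "\<kappa> < min (p / s) (p * \<beta> / n)"
    and "weight w" "A1 (\<lambda>x. w x powr s)"
    and "0 < c"
    and "lip_space \<beta> b"
  shows "\<exists>C. \<forall>f. morrey_space p \<kappa> (\<lambda>x. w x powr p) (\<lambda>x. w x powr s) f \<longrightarrow>
     morrey_space s (\<kappa> * s / p) (\<lambda>x. w x powr s) (\<lambda>x. w x powr s) (commutator b c \<alpha> f) \<and>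
     morrey_norm s (\<kappa> * s / p) (\<lambda>x. w x powr s) (\<lambda>x. w x powr s) (commutator b c \<alpha> f)
       \<le> C * lip_norm \<beta> b * morrey_norm p \<kappa> (\<lambda>x. w x powr p) (\<lambda>x. w x powr s) f"
proof -
  define v where "v = (\<lambda>x. w x powr s)"
  define N where "N = morrey_norm p \<kappa> (\<lambda>x. w x powr p) v"
  have v_weight: "weight v" using \<open>A1 (\<lambda>x. w x powr s)\<close> by (simp add: A1_def v_def)
  have "(\<alpha> + \<beta>) / n < 1 / p" using assms by (simp add: field_simps)
  then have "0 < 1 / s" using assms by simp
  then have s_pos: "0 < s" by simp
  obtain C where C_pos: "0 < C"
    and riesz_le: "\<And>f Q. morrey_space p \<kappa> (\<lambda>x. w x powr p) v f \<Longrightarrow> cube Q \<Longrightarrow>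
      (\<integral>\<^sup>+x\<in>Q. riesz_potential (\<alpha> + \<beta>) f x epowr s * ennreal (v x) \<partial>lborel)
        \<le> ennreal ((C * N f) powr s * wmeas v Q powr (\<kappa> * s / p))"
    using riesz_potential_weighted_morrey[of w s "\<alpha> + \<beta>" p \<kappa>] assms s_pos
    unfolding v_def N_def n_def by auto
  have "morrey_space s (\<kappa> * s / p) v v (commutator b c \<alpha> f) \<and>
      morrey_norm s (\<kappa> * s / p) v v (commutator b c \<alpha> f)
        \<le> c * (campanato_const DIM('a) \<beta> * lip_norm \<beta> b) * (C * N f)"
    if f_morrey: "morrey_space p \<kappa> (\<lambda>x. w x powr p) v f" for f
    using assms s_pos C_pos v_weight f_morrey morrey_norm_nonneg[OF f_morrey]
    by (intro conjI morrey_space_commutator[where \<beta> = \<beta> and N = "C * N f"]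
          morrey_norm_commutator_le riesz_le wmeas_pos)
      (simp_all add: v_def N_def morrey_space_def weight_def loc_int_def)
  then show ?thesis
    unfolding v_def N_def
    by (intro exI[of _ "c * campanato_const DIM('a) \<beta> * C"]) (simp add: mult_ac)
qed

end
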